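(* Let $K$ be an algebraically closed field of characteristic zero and let $m\ge 1$ be an integer. Any artinian Gorenstein standard graded $K$-algebra $A$ of codimension $3$ and odd socle degree $2m+1$ with $h$-vector $$(1,3,5,7,9,\dots,2m-1,2m+1,2m+1,2m-1,\dots,9,7,5,3,1),$$ i.e. $h_i=h_{2m+1-i}=2i+1$ for $0\le i\le m$, satisfies the weak Lefschetz property.
   Context: A standard graded artinian $K$-algebra is $A=R/I$ with $R=K[x_1,\dots,x_n]$ (standard grading) and $I$ a homogeneous ideal such that $\dim_K A<\infty$. The codimension of $A$ is the number of variables $n$ of $R$ (equal to $h_1$ when $I$ contains no linear forms). Its $h$-vector is $(h_0,\dots,h_d)$ with $h_i=\dim_K[A]_i>0$ for $0\le i\le d$, where $d$ is the largest degree in which $A$ is nonzero; $d$ is called the socle degree. $A$ is Gorenstein if its socle is one-dimensional, concentrated in degree $d$ (then its $h$-vector is symmetric). $A$ has the weak Lefschetz property (WLP) if there is a linear form $\ell\in[A]_1$ such that for every integer $i\ge 0$ the multiplication map $\times\ell\colon[A]_i\to[A]_{i+1}$ has maximal rank (i.e. is injective or surjective). *)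

theory Defs
  imports
    "HOL-Algebra.Algebraic_Closure_Type"
    "HOL-Algebra.Embedded_Algebras"
    "HOL-Library.Poly_Mapping"
    "HOL-Library.Numeral_Type"
begin

text \<open>
  A polynomial with variables indexed by \<open>'x\<close> is a finitely supported map from monomials
  (finitely supported exponent vectors) to coefficients; its ring structure is the convolution
  product of the library. The number of variables is \<open>CARD('x)\<close>.
\<close>

type_synonym ('x, 'k) pol = "('x \<Rightarrow>\<^sub>0 nat) \<Rightarrow>\<^sub>0 'k"

abbreviation pol_ring :: "('x, 'k::field) pol ring" where
  "pol_ring \<equiv> ring_of_type_algebra"

definition mon_degree :: "('x::finite \<Rightarrow>\<^sub>0 nat) \<Rightarrow> nat" where
  "mon_degree t = (\<Sum>x\<in>UNIV. Poly_Mapping.lookup t x)"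

text \<open>The space \<open>[R]\<^sub>d\<close>; it contains the zero polynomial.\<close>

definition forms :: "nat \<Rightarrow> ('x::finite, 'k::field) pol set" where
  "forms d = {p. \<forall>t\<in>Poly_Mapping.keys p. mon_degree t = d}"

definition homogeneous_ideal :: "('x::finite, 'k::field) pol set \<Rightarrow> bool" where
  "homogeneous_ideal I \<longleftrightarrow> (\<exists>S \<subseteq> (\<Union>d. forms d). I = Idl\<^bsub>pol_ring\<^esub> S)"

text \<open>The algebra \<open>A = R/I\<close>, whose elements are the cosets of \<open>I\<close>.\<close>

abbreviation quot_alg :: "('x, 'k::field) pol set \<Rightarrow> ('x, 'k) pol set ring" where
  "quot_alg I \<equiv> pol_ring Quot I"

text \<open>
  The copy of \<open>K\<close> inside \<open>A\<close>. Dimensions over \<open>K\<close> are taken in the sense of \<open>Embedded_Algebras\<close>, which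
  expects the scalars to be a subset of the ambient ring.
\<close>

definition scalars :: "('x, 'k::field) pol set \<Rightarrow> ('x, 'k) pol set set" where
  "scalars I = (\<lambda>c. I +>\<^bsub>pol_ring\<^esub> Poly_Mapping.single 0 c) ` UNIV"

definition graded_piece :: "('x::finite, 'k::field) pol set \<Rightarrow> nat \<Rightarrow> ('x, 'k) pol set set" where
  "graded_piece I i = (\<lambda>f. I +>\<^bsub>pol_ring\<^esub> f) ` forms i"

definition artinian :: "('x, 'k::field) pol set \<Rightarrow> bool" where
  "artinian I \<longleftrightarrow> ring.finite_dimension (quot_alg I) (scalars I) (carrier (quot_alg I))"

definition hilbert_fun :: "('x::finite, 'k::field) pol set \<Rightarrow> nat \<Rightarrow> nat" where
  "hilbert_fun I i = ring.dim (quot_alg I) (scalars I) (graded_piece I i)"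

text \<open>Only meaningful if \<open>A\<close> is nonzero and artinian; otherwise the maximum is unspecified.\<close>

definition socle_degree :: "('x::finite, 'k::field) pol set \<Rightarrow> nat" where
  "socle_degree I = Max {i. graded_piece I i \<noteq> {\<zero>\<^bsub>quot_alg I\<^esub>}}"

definition irrelevant_ideal :: "('x::finite, 'k::field) pol set \<Rightarrow> ('x, 'k) pol set set" where
  "irrelevant_ideal I = Idl\<^bsub>quot_alg I\<^esub> (\<Union>i\<in>{1..}. graded_piece I i)"

definition socle :: "('x::finite, 'k::field) pol set \<Rightarrow> ('x, 'k) pol set set" where
  "socle I = {a \<in> carrier (quot_alg I).
     \<forall>b\<in>irrelevant_ideal I. b \<otimes>\<^bsub>quot_alg I\<^esub> a = \<zero>\<^bsub>quot_alg I\<^esub>}"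

text \<open>For artinian \<open>A\<close>: the socle is one-dimensional and concentrated in the top degree.\<close>

definition gorenstein :: "('x::finite, 'k::field) pol set \<Rightarrow> bool" where
  "gorenstein I \<longleftrightarrow> ring.dimension (quot_alg I) 1 (scalars I) (socle I) \<and>
     socle I \<subseteq> graded_piece I (socle_degree I)"

definition weak_lefschetz :: "('x::finite, 'k::field) pol set \<Rightarrow> bool" where
  "weak_lefschetz I \<longleftrightarrow> (\<exists>l\<in>graded_piece I 1. \<forall>i.
     inj_on (\<lambda>a. l \<otimes>\<^bsub>quot_alg I\<^esub> a) (graded_piece I i) \<or>
     (\<lambda>a. l \<otimes>\<^bsub>quot_alg I\<^esub> a) ` graded_piece I i = graded_piece I (i + 1))"

end

theory Submission
  imports Defs
begin

text \<open>
  Let \<open>R = K[x,y,z]\<close> and \<open>A = R/I\<close>. Everything reduces to a single degree: it suffices to find a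
  linear form \<open>l\<close> with \<open>A\<^bsub>m+1\<^esub> = l A\<^sub>m\<close>. Then multiplication by \<open>l\<close> is onto from every degree
  \<open>i \<ge> m\<close>, because \<open>A\<close> is generated in degree one. It is one-to-one on \<open>A\<^sub>i\<close> for \<open>i \<le> m\<close> by duality:
  a nonzero element of \<open>A\<^sub>i\<close> has a nonzero product with some element of \<open>A\<^bsub>2m+1-i\<^esub>\<close>, and that element
  is a multiple of \<open>l\<close> (\<open>weak_lefschetzI\<close>).

  Since \<open>dim A\<^sub>2 < 6\<close>, the ideal contains a nonzero quadric \<open>q\<close>. In suitable linear coordinates
  \<open>q = x z - c y\<^sup>2\<close>, where \<open>c = 0\<close> is a pair of lines, or \<open>q\<close> is a multiple of \<open>x\<^sup>2\<close>
  (\<open>quadric_normal_form\<close>). Modulo \<open>q\<close> the forms of degree \<open>d\<close> are spanned by \<open>2d+1\<close> monomials.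
  Hence \<open>dim A\<^sub>m = 2m+1\<close> means that the forms of degree \<open>m\<close> in \<open>I\<close> are multiples of \<open>q\<close>, and
  \<open>dim A\<^bsub>m+1\<^esub> = 2m+1\<close> yields two forms \<open>f, g \<in> I\<close> of degree \<open>m+1\<close> whose expansions in the \<open>2m+3\<close>
  monomials are linearly independent.

  A line \<open>l = 0\<close> cuts the conic \<open>q = 0\<close> in two points, and modulo \<open>(q, l)\<close> a form of degree \<open>m+1\<close>
  is determined by its values at these two points. So \<open>R\<^bsub>m+1\<^esub> = l R\<^sub>m + I\<^bsub>m+1\<^esub>\<close> as soon as the two by
  two determinant of the values of \<open>f\<close> and \<open>g\<close> is nonzero (\<open>lefschetz_of_two_generators\<close>,
  \<open>conic_secant\<close>). If this determinant vanished for all lines, the ratio of \<open>f\<close> and \<open>g\<close> would be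
  constant along the conic, and a nontrivial combination of \<open>f\<close> and \<open>g\<close> would vanish on it and be a
  multiple of \<open>q\<close>. The argument fails only when \<open>c = 0\<close> and \<open>f\<close> and \<open>g\<close> both vanish on one of the two
  lines. For a double line the second value is a derivative in the normal direction
  (\<open>double_line_secant\<close>), the determinant contains a Wronskian, and in characteristic zero one finds
  that \<open>f\<close> and \<open>g\<close> both vanish on the line.

  In the remaining cases \<open>f = w F\<close> and \<open>g = w G\<close> modulo \<open>q\<close>, where \<open>w\<close> is a linear factor of \<open>q\<close> and
  \<open>F\<close>, \<open>G\<close> are independent forms of degree \<open>m\<close> in the two variables not killed by \<open>w\<close>. This
  contradicts the Gorenstein property (\<open>annihilated_binary_forms_dependent\<close>): \<open>A/(0 : w)\<close> is a
  Gorenstein quotient of a polynomial ring in two variables, of socle degree \<open>2m\<close>. It has dimension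
  \<open>m\<close> in degree \<open>m-1\<close>, hence also in degree \<open>m+1\<close>, whereas two independent relations in degree \<open>m\<close>
  leave at most \<open>m-1\<close> dimensions in degree \<open>m+1\<close>.
\<close>

section \<open>Linear systems and pairs of polynomials\<close>

text \<open>
  Gaussian elimination on the equations: solve one equation for an unknown that occurs in it and
  substitute into the others.
\<close>

lemma homogeneous_system_nontrivial:
  fixes M :: "'e \<Rightarrow> 'v \<Rightarrow> 'k::field"
  assumes "finite E" and "finite V" and "card E < card V"
  shows "\<exists>x. (\<exists>v\<in>V. x v \<noteq> 0) \<and> (\<forall>e\<in>E. (\<Sum>v\<in>V. M e v * x v) = 0)"
  using assms
proof (induction E arbitrary: V M rule: finite_induct)
  case empty
  then obtain v where "v \<in> V" by fastforce
  then show ?case by (intro exI[of _ "\<lambda>_. 1"]) auto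
next
  case (insert e E)
  show ?case
  proof (cases "\<forall>v\<in>V. M e v = 0")
    case True
    have "card E < card V" using insert by simp
    with insert.IH[OF insert.prems(1)] obtain x where
      "\<exists>v\<in>V. x v \<noteq> 0" "\<forall>e\<in>E. (\<Sum>v\<in>V. M e v * x v) = 0" by blast
    with True show ?thesis by (intro exI[of _ x]) auto
  next
    case False
    then obtain u where u: "u \<in> V" "M e u \<noteq> 0" by blast
    define W where "W = V - {u}"
    have W: "finite W" "card E < card W" "u \<notin> W" and V: "V = insert u W"
      using insert u by (auto simp: W_def)
    obtain x where x: "\<exists>v\<in>W. x v \<noteq> 0"
        "\<forall>e'\<in>E. (\<Sum>v\<in>W. (M e' v - M e' u * M e v / M e u) * x v) = 0"
      using insert.IH[OF W(1,2), of "\<lambda>e' v. M e' v - M e' u * M e v / M e u"] by blast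
    define s where "s = (\<Sum>v\<in>W. M e v * x v)"
    define x' where "x' = x(u := - s / M e u)"
    have split: "(\<Sum>v\<in>V. M e' v * x' v) = M e' u * (- s / M e u) + (\<Sum>v\<in>W. M e' v * x v)" for e'
    proof -
      have "(\<Sum>v\<in>W. M e' v * x' v) = (\<Sum>v\<in>W. M e' v * x v)"
        using W(3) by (intro sum.cong) (auto simp: x'_def)
      then show ?thesis using W by (simp add: V x'_def)
    qed
    have "(\<Sum>v\<in>V. M e' v * x' v) = 0" if "e' \<in> E" for e'
    proof -
      have "0 = (\<Sum>v\<in>W. M e' v * x v - (M e' u / M e u) * (M e v * x v))"
        using x(2) that by (simp add: algebra_simps)
      also have "\<dots> = (\<Sum>v\<in>W. M e' v * x v) - (M e' u / M e u) * s"
        by (simp add: sum_subtractf sum_distrib_left s_def)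
      finally show ?thesis by (simp add: split)
    qed
    moreover have "(\<Sum>v\<in>V. M e v * x' v) = 0"
      using u by (simp add: split s_def)
    moreover have "\<exists>v\<in>V. x' v \<noteq> 0" using x(1) W(3) by (auto simp: V x'_def)
    ultimately show ?thesis by blast
  qed
qed

text \<open>
  The leading coefficients of the two products differ by the factor
  \<open>degree v - degree u\<close>, which is nonzero in characteristic zero.
\<close>

lemma wronskian_nonzero_of_degree_less:
  fixes u v :: "'k::field_char_0 poly"
  assumes "u \<noteq> 0" and "v \<noteq> 0" and "Polynomial.degree u < Polynomial.degree v"
  shows "u * pderiv v \<noteq> pderiv u * v"
proof
  assume eq: "u * pderiv v = pderiv u * v"
  define a b where "a = Polynomial.degree u" and "b = Polynomial.degree v"
  have b: "b > 0" using assms by (simp add: b_def)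
  have "coeff (u * pderiv v) (a + (b - 1)) = coeff u a * coeff (pderiv v) (b - 1)"
    using coeff_mult_degree_sum[of u "pderiv v"] by (simp add: degree_pderiv a_def b_def)
  also have "coeff (pderiv v) (b - 1) = of_nat b * coeff v b"
    using b by (simp add: coeff_pderiv)
  finally have 1: "coeff (u * pderiv v) (a + (b - 1)) = of_nat b * (coeff u a * coeff v b)"
    by (simp add: mult_ac)
  have 2: "coeff (pderiv u * v) (a + (b - 1)) = of_nat a * (coeff u a * coeff v b)"
  proof (cases "a = 0")
    case True
    then have "pderiv u = 0" by (simp add: a_def pderiv_eq_0_iff)
    then show ?thesis using True by simp
  next
    case False
    have "coeff (pderiv u * v) ((a - 1) + b) = coeff (pderiv u) (a - 1) * coeff v b"
      using coeff_mult_degree_sum[of "pderiv u" v] by (simp add: degree_pderiv a_def b_def)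
    moreover have "coeff (pderiv u) (a - 1) = of_nat a * coeff u a"
      using False by (simp add: coeff_pderiv)
    moreover have "(a - 1) + b = a + (b - 1)" using False b by simp
    ultimately show ?thesis by (simp add: mult_ac)
  qed
  have "coeff u a * coeff v b \<noteq> 0" using assms by (simp add: a_def b_def)
  with 1 2 eq have "(of_nat a :: 'k) = of_nat b" by simp
  with assms(3) show False by (simp add: a_def b_def)
qed

definition lin_indep2 :: "'k::field poly \<Rightarrow> 'k poly \<Rightarrow> bool" where
  "lin_indep2 P Q \<longleftrightarrow> (\<forall>a b. smult a P + smult b Q = 0 \<longrightarrow> a = 0 \<and> b = 0)"

text \<open>
  If both polynomials have the same degree, cancelling the leading term of one against the other
  lowers the degree of one of them. Distinct degrees make leading-term arguments available.
\<close>

lemma lin_indep2_distinct_degrees: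
  fixes P Q :: "'k::field poly"
  assumes "lin_indep2 P Q"
  obtains a b c d where "smult a P + smult b Q \<noteq> 0" and "smult c P + smult d Q \<noteq> 0"
    and "Polynomial.degree (smult a P + smult b Q) < Polynomial.degree (smult c P + smult d Q)"
proof -
  have ne: "smult a P + smult b Q \<noteq> 0" if "a \<noteq> 0 \<or> b \<noteq> 0" for a b
    using assms that by (auto simp: lin_indep2_def)
  consider "Polynomial.degree P < Polynomial.degree Q" | "Polynomial.degree Q < Polynomial.degree P"
    | "Polynomial.degree P = Polynomial.degree Q" by linarith
  then show thesis
  proof cases
    case 1
    then show thesis using that[of 1 0 0 1] ne[of 1 0] ne[of 0 1] by simp
  next
    case 2
    then show thesis using that[of 0 1 1 0] ne[of 1 0] ne[of 0 1] by simp
  next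
    case 3
    define n where "n = Polynomial.degree P"
    have lc: "coeff P n \<noteq> 0" "coeff Q n \<noteq> 0"
      using ne[of 1 0] ne[of 0 1] 3 leading_coeff_0_iff[of P] leading_coeff_0_iff[of Q]
      by (auto simp: n_def simp del: leading_coeff_0_iff)
    define u where "u = smult (coeff Q n) P + smult (- coeff P n) Q"
    have u0: "u \<noteq> 0" unfolding u_def using ne lc by blast
    have "coeff u n = 0" by (simp add: u_def)
    moreover have "Polynomial.degree u \<le> n" unfolding u_def
      using 3 by (intro degree_add_le) (auto simp: n_def)
    ultimately have "Polynomial.degree u < n"
      using u0 by (metis le_neq_implies_less leading_coeff_0_iff)
    then show thesis using that[of "coeff Q n" "- coeff P n" 1 0] u0 ne[of 1 0]
      by (simp add: n_def u_def)
  qed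
qed

lemma wronskian_nonzero:
  fixes P Q :: "'k::field_char_0 poly"
  assumes "lin_indep2 P Q"
  shows "P * pderiv Q \<noteq> pderiv P * Q"
proof
  assume eq: "P * pderiv Q = pderiv P * Q"
  obtain a b c d where ne: "smult a P + smult b Q \<noteq> 0" "smult c P + smult d Q \<noteq> 0"
    and lt: "Polynomial.degree (smult a P + smult b Q) < Polynomial.degree (smult c P + smult d Q)"
    using lin_indep2_distinct_degrees[OF assms] .
  have "(smult a P + smult b Q) * pderiv (smult c P + smult d Q)
      - pderiv (smult a P + smult b Q) * (smult c P + smult d Q)
      = smult (a * d - b * c) (P * pderiv Q - pderiv P * Q)"
    by (simp add: pderiv_add pderiv_smult algebra_simps smult_add_left smult_diff_left
        smult_diff_right smult_add_right)
  then show False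
    using wronskian_nonzero_of_degree_less[OF ne lt] eq by simp
qed

section \<open>Forms and their homogeneous components\<close>

abbreviation cst :: "'k::field \<Rightarrow> ('x, 'k) pol" where
  "cst c \<equiv> Poly_Mapping.single 0 c"

lemma cst_mult: "cst (a * b) = cst a * cst b"
  by (simp add: mult_single)

lemma cst_power: "cst (a ^ n) = cst a ^ n"
  by (induction n) (simp_all add: cst_mult)

lemma cst_sum: "cst (sum f S) = (\<Sum>i\<in>S. cst (f i))"
  by (induction S rule: infinite_finite_induct) (simp_all add: single_add)

lemmas cst_hom = cst_mult cst_power single_add single_diff single_uminus single_one single_zero

lemma mon_degree_add: "mon_degree (s + t) = mon_degree s + mon_degree t"
  by (simp add: mon_degree_def lookup_add sum.distrib)

lemma mon_degree_zero [simp]: "mon_degree 0 = 0"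
  by (simp add: mon_degree_def)

lemma forms_zero [simp]: "0 \<in> forms d"
  by (simp add: forms_def)

lemma forms_add: "p \<in> forms d \<Longrightarrow> q \<in> forms d \<Longrightarrow> p + q \<in> forms d"
  using keys_add[of p q] by (auto simp: forms_def)

lemma forms_mult: "p \<in> forms d \<Longrightarrow> q \<in> forms e \<Longrightarrow> p * q \<in> forms (d + e)"
  using keys_mult[of p q] by (fastforce simp: forms_def mon_degree_add)

lemma forms_cst [simp]: "cst c \<in> forms 0"
  by (simp add: forms_def)

lemma forms_cst_mult: "p \<in> forms d \<Longrightarrow> cst c * p \<in> forms d"
  using forms_mult[OF forms_cst] by fastforce

lemma forms_uminus: "p \<in> forms d \<Longrightarrow> - p \<in> forms d"
  using forms_cst_mult[of p d "-1"] by (simp add: single_uminus)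

lemma forms_diff: "p \<in> forms d \<Longrightarrow> q \<in> forms d \<Longrightarrow> p - q \<in> forms d"
  using forms_add[of p d "- q"] forms_uminus by fastforce

lemma forms_sum: "(\<And>i. i \<in> S \<Longrightarrow> f i \<in> forms d) \<Longrightarrow> sum f S \<in> forms d"
  by (induction S rule: infinite_finite_induct) (auto intro: forms_add)

lemma forms_one: "1 \<in> forms 0"
  using forms_cst[of 1] by simp

lemma forms_power: "l \<in> forms 1 \<Longrightarrow> l ^ n \<in> forms n"
  by (induction n) (auto simp: forms_one intro: forms_mult[of l 1 _ n for n, simplified])

lemma forms_Suc_mult: "l \<in> forms 1 \<Longrightarrow> p \<in> forms d \<Longrightarrow> l * p \<in> forms (Suc d)"
  using forms_mult[of l 1 p d] by simp

lemma sum_of_terms: "p = (\<Sum>t\<in>Poly_Mapping.keys p. Poly_Mapping.single t (Poly_Mapping.lookup p t))"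
  by (rule poly_mapping_eqI)
     (auto simp: lookup_sum lookup_single when_def not_in_keys_iff_lookup_eq_zero)

text \<open>
  Forms are generated from constants by addition and by multiplication with linear forms. Using
  arbitrary linear forms instead of the variables makes the induction independent of the choice of
  coordinates.
\<close>

lemma form_induct [consumes 1, case_names const zero add mult]:
  assumes "r \<in> forms d"
    and const: "\<And>c. P 0 (cst c)"
    and zero: "\<And>d. P d 0"
    and add: "\<And>d p q. p \<in> forms d \<Longrightarrow> q \<in> forms d \<Longrightarrow> P d p \<Longrightarrow> P d q \<Longrightarrow> P d (p + q)"
    and mult: "\<And>d l p. l \<in> forms 1 \<Longrightarrow> p \<in> forms d \<Longrightarrow> P d p \<Longrightarrow> P (Suc d) (l * p)"
  shows "P d r"
proof -
  have single: "P d (Poly_Mapping.single t c)" if "mon_degree t = d" for t c d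
    using that
  proof (induction d arbitrary: t)
    case 0
    then have "t = 0" by (intro poly_mapping_eqI) (auto simp: mon_degree_def)
    then show ?case using const by simp
  next
    case (Suc d)
    obtain x where x: "Poly_Mapping.lookup t x > 0"
      using Suc.prems unfolding mon_degree_def
      by (metis Zero_not_Suc bot_nat_0.not_eq_extremum sum.neutral)
    define e :: "'a \<Rightarrow>\<^sub>0 nat" where "e = Poly_Mapping.single x 1"
    define s where "s = t - e"
    have t: "t = e + s"
      by (rule poly_mapping_eqI) (use x in \<open>auto simp: s_def e_def lookup_add lookup_minus lookup_single when_def\<close>)
    have e: "mon_degree e = 1"
      by (simp add: e_def mon_degree_def lookup_single when_def)
    have s: "mon_degree s = d" using Suc.prems by (simp add: t mon_degree_add e)
    have "Poly_Mapping.single t c = Poly_Mapping.single e 1 * Poly_Mapping.single s c"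
      by (simp add: t mult_single)
    moreover have "Poly_Mapping.single e (1::'b) \<in> forms 1"
      "Poly_Mapping.single s c \<in> forms d" by (simp_all add: forms_def e s)
    ultimately show ?case using mult Suc.IH[OF s] by simp
  qed
  have "(\<Sum>t\<in>T. Poly_Mapping.single t (Poly_Mapping.lookup r t)) \<in> forms d \<and>
      P d (\<Sum>t\<in>T. Poly_Mapping.single t (Poly_Mapping.lookup r t))"
    if "finite T" "T \<subseteq> Poly_Mapping.keys r" for T
    using that
  proof (induction T rule: finite_induct)
    case (insert t T)
    then have "mon_degree t = d" using assms(1) by (auto simp: forms_def)
    moreover from this have "Poly_Mapping.single t (Poly_Mapping.lookup r t) \<in> forms d"
      by (simp add: forms_def)
    ultimately show ?case using insert single by (auto intro!: add forms_add)
  qed (simp add: zero)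
  from this[of "Poly_Mapping.keys r"] show ?thesis using sum_of_terms[of r] by simp
qed

definition component :: "nat \<Rightarrow> ('x::finite, 'k::field) pol \<Rightarrow> ('x, 'k) pol" where
  "component d p = (\<Sum>t | t \<in> Poly_Mapping.keys p \<and> mon_degree t = d.
     Poly_Mapping.single t (Poly_Mapping.lookup p t))"

lemma lookup_component:
  "Poly_Mapping.lookup (component d p) t = (Poly_Mapping.lookup p t when mon_degree t = d)"
  by (auto simp: component_def lookup_sum lookup_single when_def not_in_keys_iff_lookup_eq_zero)

lemma component_add: "component d (p + q) = component d p + component d q"
  by (rule poly_mapping_eqI) (simp add: lookup_component lookup_add when_def)

lemma component_diff: "component d (p - q) = component d p - component d q"
  by (rule poly_mapping_eqI) (simp add: lookup_component lookup_minus when_def)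

lemma component_zero [simp]: "component d 0 = 0"
  by (rule poly_mapping_eqI) (simp add: lookup_component)

lemma component_sum: "component d (sum f S) = (\<Sum>i\<in>S. component d (f i))"
  by (induction S rule: infinite_finite_induct) (simp_all add: component_add)

lemma component_form: "p \<in> forms e \<Longrightarrow> component d p = (if d = e then p else 0)"
  by (rule poly_mapping_eqI)
     (auto simp: lookup_component when_def forms_def in_keys_iff)

lemma component_in_forms: "component d p \<in> forms d"
  by (auto simp: forms_def in_keys_iff lookup_component when_def split: if_splits)

lemma sum_of_components: "p = (\<Sum>e\<in>mon_degree ` Poly_Mapping.keys p. component e p)"
  by (rule poly_mapping_eqI)
     (auto simp: lookup_component lookup_sum when_def in_keys_iff)

lemma component_mult:
  "component d (r * p) = (\<Sum>i\<in>mon_degree ` Poly_Mapping.keys r. \<Sum>j\<in>mon_degree ` Poly_Mapping.keys p.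
     if d = i + j then component i r * component j p else 0)"
proof -
  have "r * p = (\<Sum>i\<in>mon_degree ` Poly_Mapping.keys r. \<Sum>j\<in>mon_degree ` Poly_Mapping.keys p.
      component i r * component j p)"
    by (subst sum_of_components[of r], subst sum_of_components[of p]) (rule sum_product)
  then show ?thesis
    by (simp add: component_sum component_form[OF forms_mult[OF component_in_forms component_in_forms]]
        cong: sum.cong)
qed

lemma component_linear_mult:
  assumes "l \<in> forms 1"
  shows "component (Suc d) (l * p) = l * component d p"
proof -
  have "l * p = (\<Sum>j\<in>mon_degree ` Poly_Mapping.keys p. l * component j p)"
    by (subst sum_of_components[of p]) (rule sum_distrib_left)
  then have "component (Suc d) (l * p) =
      (\<Sum>j\<in>mon_degree ` Poly_Mapping.keys p. if d = j then l * component j p else 0)"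
    by (simp add: component_sum component_form[OF forms_Suc_mult[OF assms component_in_forms]]
        cong: sum.cong)
  also have "\<dots> = l * component d p"
  proof (cases "d \<in> mon_degree ` Poly_Mapping.keys p")
    case False
    then have "component d p = 0" by (auto simp: component_def intro!: sum.neutral)
    then show ?thesis using False by simp
  qed simp
  finally show ?thesis .
qed

section \<open>Homogeneous ideals and their quotients\<close>

lemma pol_ring_simps [simp]:
  "carrier pol_ring = UNIV" "monoid.mult pol_ring = (*)" "ring.add pol_ring = (+)"
  "monoid.one pol_ring = 1" "ring.zero pol_ring = 0"
  by (auto simp: ring_of_type_algebra_def fun_eq_iff)

lemma ring_pol_ring: "ring pol_ring" and cring_pol_ring: "cring pol_ring"
  by (rule ring_from_type_algebra cring_from_type_algebra)+

lemma ideal_pol_ringI: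
  assumes "0 \<in> J" and "\<And>a b. a \<in> J \<Longrightarrow> b \<in> J \<Longrightarrow> a + b \<in> J" and "\<And>r a. a \<in> J \<Longrightarrow> r * a \<in> J"
  shows "ideal J pol_ring"
proof (rule idealI[OF ring_pol_ring])
  interpret ring pol_ring by (rule ring_pol_ring)
  show "subgroup J (add_monoid pol_ring)"
  proof (rule add.subgroupI)
    fix a assume "a \<in> J"
    then have "- a \<in> J" using assms(3)[of a "-1"] by simp
    moreover have "\<ominus>\<^bsub>pol_ring\<^esub> a = - a" by (rule minus_equality) simp_all
    ultimately show "\<ominus>\<^bsub>pol_ring\<^esub> a \<in> J" by simp
  qed (use assms in auto)
qed (use assms(3) in \<open>auto simp: mult.commute\<close>)

text \<open>
  An ideal of a ring given by a type class, as opposed to a record. The ideals that occur are \<open>I\<close>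
  itself and the ideals \<open>I + (l)\<close> for linear forms \<open>l\<close>.
\<close>

locale comm_ideal =
  fixes J :: "'a::comm_ring_1 set"
  assumes zero_mem [simp]: "0 \<in> J"
    and add_mem: "a \<in> J \<Longrightarrow> b \<in> J \<Longrightarrow> a + b \<in> J"
    and mult_mem: "a \<in> J \<Longrightarrow> r * a \<in> J"
begin

lemma uminus_mem: "a \<in> J \<Longrightarrow> - a \<in> J"
  using mult_mem[of a "-1"] by simp

lemma diff_mem: "a \<in> J \<Longrightarrow> b \<in> J \<Longrightarrow> a - b \<in> J"
  using add_mem[of a "- b"] uminus_mem by simp

lemma sum_mem: "(\<And>i. i \<in> S \<Longrightarrow> f i \<in> J) \<Longrightarrow> sum f S \<in> J"
  by (induction S rule: infinite_finite_induct) (auto intro: add_mem)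

definition eqv :: "'a \<Rightarrow> 'a \<Rightarrow> bool" (infix \<open>\<approx>\<close> 50) where
  "a \<approx> b \<longleftrightarrow> a - b \<in> J"

lemma eqv_refl [simp]: "a \<approx> a" by (simp add: eqv_def)

lemma eqv_sym: "a \<approx> b \<Longrightarrow> b \<approx> a"
  using uminus_mem[of "a - b"] by (simp add: eqv_def)

lemma eqv_trans [trans]: "a \<approx> b \<Longrightarrow> b \<approx> c \<Longrightarrow> a \<approx> c"
  using add_mem[of "a - b" "b - c"] by (simp add: eqv_def)

lemma eqv_add: "a \<approx> b \<Longrightarrow> c \<approx> d \<Longrightarrow> a + c \<approx> b + d"
  using add_mem[of "a - b" "c - d"] by (simp add: eqv_def algebra_simps)

lemma eqv_mult: "a \<approx> b \<Longrightarrow> c \<approx> d \<Longrightarrow> a * c \<approx> b * d"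
  using add_mem[OF mult_mem[of "a - b" c] mult_mem[of "c - d" b]]
  by (simp add: eqv_def algebra_simps)

lemma eqv_sum: "(\<And>i. i \<in> S \<Longrightarrow> f i \<approx> g i) \<Longrightarrow> sum f S \<approx> sum g S"
  by (induction S rule: infinite_finite_induct) (auto intro: eqv_add)

lemma eqv_mem_iff: "a \<approx> b \<Longrightarrow> a \<in> J \<longleftrightarrow> b \<in> J"
  using add_mem[of "a - b" b] diff_mem[of a "a - b"] by (auto simp: eqv_def)

end

locale graded_quotient =
  fixes I :: "('x::finite, 'k::field) pol set"
  assumes homogeneous: "homogeneous_ideal I" and artinian: "artinian I" and proper: "I \<noteq> UNIV"
begin

abbreviation "R \<equiv> (pol_ring :: ('x, 'k) pol ring)"
abbreviation "A \<equiv> quot_alg I"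
abbreviation "K \<equiv> scalars I"
abbreviation "coset \<equiv> (+>\<^bsub>R\<^esub>) I"

lemma is_ideal: "ideal I R"
proof -
  interpret ring R by (rule ring_pol_ring)
  from homogeneous obtain S where "I = Idl\<^bsub>R\<^esub> S" by (auto simp: homogeneous_ideal_def)
  then show ?thesis by (simp add: genideal_ideal)
qed

sublocale comm_ideal I
proof
  interpret ideal I R by (rule is_ideal)
  show "0 \<in> I" using additive_subgroup.zero_closed[OF is_additive_subgroup] by simp
  show "a + b \<in> I" if "a \<in> I" "b \<in> I" for a b using additive_subgroup.a_closed[OF is_additive_subgroup that] by simp
  show "r * a \<in> I" if "a \<in> I" for r a using I_l_closed[OF that, of r] by simp
qed

notation eqv (infix \<open>\<approx>\<close> 50)

text \<open>
  The elements all of whose components lie in \<open>I\<close> form an ideal that contains the homogeneous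
  generators of \<open>I\<close>.
\<close>

lemma component_mem:
  assumes "p \<in> I" shows "component d p \<in> I"
proof -
  interpret ring R by (rule ring_pol_ring)
  obtain S where S: "S \<subseteq> (\<Union>d. forms d)" and I: "I = Idl\<^bsub>R\<^esub> S"
    using homogeneous by (auto simp: homogeneous_ideal_def)
  define J where "J = {p. \<forall>d. component d p \<in> I}"
  have "ideal J R"
  proof (rule ideal_pol_ringI)
    show "r * a \<in> J" if "a \<in> J" for r a
      using that by (auto simp: J_def component_mult intro!: sum_mem mult_mem)
  qed (auto simp: J_def component_add add_mem)
  moreover have "S \<subseteq> J"
  proof
    fix s assume s: "s \<in> S"
    then have "s \<in> I" using genideal_self[of S] by (auto simp: I)
    moreover from s S obtain e where "s \<in> forms e" by auto
    ultimately show "s \<in> J" by (simp add: J_def component_form)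
  qed
  ultimately have "I \<subseteq> J" unfolding I by (rule genideal_minimal)
  with assms show ?thesis by (auto simp: J_def)
qed

lemma forms_eqv_mem: "a \<in> forms d \<Longrightarrow> b \<in> forms e \<Longrightarrow> d \<noteq> e \<Longrightarrow> a \<approx> b \<Longrightarrow> a \<in> I"
  using component_mem[of "a - b" d] by (simp add: eqv_def component_diff component_form)

lemma coset_hom: "ring_hom_ring R A coset"
  using ideal.rcos_ring_hom_ring[OF is_ideal] .

lemma coset_mult: "coset f \<otimes>\<^bsub>A\<^esub> coset g = coset (f * g)"
  using ring_hom_mult[OF ring_hom_ring.homh[OF coset_hom], of f g] by simp

lemma coset_zero: "\<zero>\<^bsub>A\<^esub> = coset 0"
  using ring_hom_zero[OF ring_hom_ring.homh[OF coset_hom] ring_pol_ring ideal.quotient_is_ring[OF is_ideal]]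
  by simp

lemma coset_eq_iff: "coset f = coset g \<longleftrightarrow> f \<approx> g"
proof
  assume "coset f = coset g"
  moreover have "f \<in> coset f" by (auto simp: a_r_coset_def r_coset_def intro: bexI[of _ 0])
  ultimately obtain h where "h \<in> I" "f = h + g"
    by (auto simp: a_r_coset_def r_coset_def)
  then show "f \<approx> g" by (simp add: eqv_def)
next
  have sub: "coset f \<subseteq> coset g" if "f \<approx> g" for f g
  proof
    fix u assume "u \<in> coset f"
    then obtain h where "h \<in> I" "u = h + f" by (auto simp: a_r_coset_def r_coset_def)
    with that show "u \<in> coset g"
      by (auto simp: a_r_coset_def r_coset_def eqv_def intro!: bexI[of _ "h + (f - g)"] add_mem)
  qed
  assume "f \<approx> g"
  then show "coset f = coset g" using sub eqv_sym by blast
qed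

lemma coset_eq_zero_iff: "coset f = \<zero>\<^bsub>A\<^esub> \<longleftrightarrow> f \<in> I"
  by (simp add: coset_zero coset_eq_iff eqv_def)

lemma carrier_A: "carrier A = range coset"
  by (auto simp: FactRing_def A_RCOSETS_def RCOSETS_def a_r_coset_def)

lemma one_notin: "1 \<notin> I"
  using mult_mem[of 1] proper by auto

lemma cst_notin: "c \<noteq> 0 \<Longrightarrow> cst c \<notin> I"
  using mult_mem[of "cst c" "cst (inverse c)"] one_notin by (auto simp flip: cst_mult)

lemma subfield_cst: "subfield (range cst) R"
proof -
  interpret cring R by (rule cring_pol_ring)
  have sub: "subring (range cst) R"
  proof (rule subringI)
    fix h assume "h \<in> range (cst :: 'k \<Rightarrow> ('x, 'k) pol)"
    then obtain c where c: "h = cst c" by auto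
    have "\<ominus>\<^bsub>R\<^esub> h = cst (- c)"
      by (rule minus_equality) (simp_all add: c flip: single_add)
    then show "\<ominus>\<^bsub>R\<^esub> h \<in> range cst" by simp
  qed (auto simp flip: cst_mult single_add simp: image_iff intro: exI[of _ 1])
  show ?thesis
  proof (rule subfieldI)
    show "subcring (range cst) R" using sub by (rule subcringI) (simp add: mult.commute)
    show "Units (R\<lparr>carrier := range cst\<rparr>) = range cst - {\<zero>\<^bsub>R\<^esub>}"
    proof (intro equalityI subsetI)
      fix u assume "u \<in> Units (R\<lparr>carrier := range cst\<rparr>)"
      then show "u \<in> range cst - {\<zero>\<^bsub>R\<^esub>}" by (auto simp: Units_def)
    next
      fix u assume "u \<in> range (cst :: 'k \<Rightarrow> ('x, 'k) pol) - {\<zero>\<^bsub>R\<^esub>}"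
      then obtain c where c: "u = cst c" "c \<noteq> 0" by fastforce
      then show "u \<in> Units (R\<lparr>carrier := range cst\<rparr>)"
        by (auto simp: Units_def mult.commute simp flip: cst_mult intro!: exI[of _ "inverse c"])
    qed
  qed
qed

lemma subfield_K: "subfield K A"
proof -
  interpret ring_hom_ring R A coset by (rule coset_hom)
  have "\<one>\<^bsub>A\<^esub> = coset 1" using hom_one by simp
  then have "\<one>\<^bsub>A\<^esub> \<noteq> \<zero>\<^bsub>A\<^esub>" using one_notin by (simp add: coset_eq_zero_iff)
  from img_is_subfield(2)[OF subfield_cst this] show ?thesis
    by (simp add: scalars_def image_image)
qed

lemma combine_cosets:
  "ring.combine A (map (\<lambda>i. coset (cst (c i))) xs) (map (\<lambda>i. coset (e i)) xs) =
    coset (\<Sum>i\<leftarrow>xs. cst (c i) * e i)"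
proof -
  interpret ring_hom_ring R A coset by (rule coset_hom)
  have "R.combine (map (\<lambda>i. cst (c i)) xs) (map e xs) = (\<Sum>i\<leftarrow>xs. cst (c i) * e i)"
    by (induction xs) simp_all
  then show ?thesis
    using combine_hom[of "map (\<lambda>i. cst (c i)) xs" "map e xs"] by (simp add: comp_def)
qed

text \<open>
  The function \<open>ring.dim\<close> is a definite description, so \<open>hilbert_fun\<close> means something only for spaces
  that have a finite dimension. Here this is inherited from \<open>A\<close>.
\<close>

lemma dimension_graded_piece: "ring.dimension A (hilbert_fun I d) K (graded_piece I d)"
proof -
  interpret ring_hom_ring R A coset by (rule coset_hom)
  interpret R: cring R by (rule cring_pol_ring)
  have "subalgebra (range cst) (forms d) R"
  proof (unfold_locales)
    fix p :: "('x, 'k) pol" assume p: "p \<in> forms d"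
    have "\<ominus>\<^bsub>R\<^esub> p = - p" by (rule R.minus_equality) simp_all
    then show "inv\<^bsub>add_monoid R\<^esub> p \<in> forms d"
      using forms_uminus[OF p] by (simp add: a_inv_def)
  qed (auto intro: forms_add forms_cst_mult)
  from img_is_subalgebra[OF _ this] have "subalgebra K (graded_piece I d) A"
    by (simp add: scalars_def graded_piece_def image_image)
  then have "S.finite_dimension K (graded_piece I d)"
    using S.subalbegra_incl_imp_finite_dimension[OF subfield_K] artinian
    by (auto simp: artinian_def graded_piece_def carrier_A)
  from S.finite_dimensionE[OF subfield_K this] show ?thesis
    by (simp add: hilbert_fun_def over_def)
qed

text \<open>
  The interface between the dimension theory of the record \<open>A\<close>, stated with lists and cosets, and
  the congruences modulo \<open>I\<close> between polynomials that are used from here on.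
\<close>

lemma exists_basis:
  "\<exists>b. (\<forall>k<hilbert_fun I d. b k \<in> forms d) \<and>
     (\<forall>r\<in>forms d. \<exists>c. r \<approx> (\<Sum>k<hilbert_fun I d. cst (c k) * b k)) \<and>
     (\<forall>c. (\<Sum>k<hilbert_fun I d. cst (c k) * b k) \<in> I \<longrightarrow> (\<forall>k<hilbert_fun I d. c k = 0))"
proof -
  interpret ring_hom_ring R A coset by (rule coset_hom)
  define n where "n = hilbert_fun I d"
  have "S.dimension n K (graded_piece I d)" using dimension_graded_piece by (simp add: n_def)
  from S.exists_base[OF subfield_K this] obtain Vs where Vs: "set Vs \<subseteq> carrier A"
    "S.independent K Vs" "length Vs = n" "S.Span K Vs = graded_piece I d" by blast
  have "Vs ! k \<in> graded_piece I d" if "k < n" for k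
    using S.Span_base_incl[OF subfield_K Vs(1)] that Vs(3,4) by auto
  then have "\<forall>k. \<exists>p. k < n \<longrightarrow> p \<in> forms d \<and> Vs ! k = coset p"
    by (fastforce simp: graded_piece_def)
  then obtain b where b: "\<And>k. k < n \<Longrightarrow> b k \<in> forms d" "\<And>k. k < n \<Longrightarrow> Vs ! k = coset (b k)"
    by metis
  have Vs_map: "Vs = map (\<lambda>k. coset (b k)) [0..<n]"
    by (rule nth_equalityI) (simp_all add: Vs(3) b(2))
  have comb: "S.combine (map (\<lambda>k. coset (cst (c k))) [0..<n]) Vs =
      coset (\<Sum>k<n. cst (c k) * b k)" for c
    by (simp add: Vs_map combine_cosets interv_sum_list_conv_sum_set_nat atLeast0LessThan)
  show ?thesis unfolding n_def[symmetric]
  proof (intro exI[of _ b] conjI ballI allI impI)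
    show "\<exists>c. r \<approx> (\<Sum>k<n. cst (c k) * b k)" if "r \<in> forms d" for r
    proof -
      have "coset r \<in> S.Span K Vs" using that Vs(4) by (simp add: graded_piece_def)
      then obtain Ks where Ks: "set Ks \<subseteq> K" "length Ks = n" "coset r = S.combine Ks Vs"
        using S.Span_mem_iff_length_version[OF subfield_K Vs(1)] Vs(3) by auto
      have "\<exists>c. Ks ! k = coset (cst c)" if "k < n" for k
      proof -
        have "Ks ! k \<in> K" using Ks(1,2) nth_mem[of k Ks] that by blast
        then show ?thesis by (auto simp: scalars_def)
      qed
      then obtain c where c: "\<And>k. k < n \<Longrightarrow> Ks ! k = coset (cst (c k))" by metis
      have "Ks = map (\<lambda>k. coset (cst (c k))) [0..<n]"
        by (rule nth_equalityI) (simp_all add: Ks(2) c)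
      with Ks(3) comb[of c] show ?thesis by (auto simp: coset_eq_iff)
    qed
    show "c k = 0" if "(\<Sum>k<n. cst (c k) * b k) \<in> I" "k < n" for c k
    proof -
      let ?Ks = "map (\<lambda>k. coset (cst (c k))) [0..<n]"
      have "S.combine ?Ks Vs = \<zero>\<^bsub>A\<^esub>" using that(1) by (simp add: comb coset_eq_zero_iff)
      moreover have "set ?Ks \<subseteq> K" by (auto simp: scalars_def)
      ultimately have "set (take (length Vs) ?Ks) \<subseteq> {\<zero>\<^bsub>A\<^esub>}"
        using S.independent_imp_trivial_combine[OF subfield_K Vs(2)] by blast
      then have "\<forall>k<n. cst (c k) \<in> I"
        by (auto simp: Vs(3) image_subset_iff coset_eq_zero_iff)
      then show ?thesis using cst_notin that(2) by blast
    qed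
  qed (use b in auto)
qed

end

section \<open>Linear relations in a graded piece\<close>

lemma sum_cst_swap:
  "(\<Sum>i\<in>S. cst (x i) * (\<Sum>k\<in>T. cst (M i k) * b k)) = (\<Sum>k\<in>T. cst (\<Sum>i\<in>S. M i k * x i) * b k)"
proof -
  have "(\<Sum>i\<in>S. cst (x i) * (\<Sum>k\<in>T. cst (M i k) * b k)) =
      (\<Sum>i\<in>S. \<Sum>k\<in>T. cst (M i k * x i) * b k)"
    by (simp add: sum_distrib_left cst_mult mult_ac)
  also have "\<dots> = (\<Sum>k\<in>T. \<Sum>i\<in>S. cst (M i k * x i) * b k)" by (rule sum.swap)
  finally show ?thesis by (simp add: cst_sum sum_distrib_right)
qed

context graded_quotient
begin

lemma exists_relation:
  assumes "finite S" and "hilbert_fun I d < card S" and e: "\<And>i. i \<in> S \<Longrightarrow> e i \<in> forms d"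
  obtains c where "\<exists>i\<in>S. c i \<noteq> 0" and "(\<Sum>i\<in>S. cst (c i) * e i) \<in> I"
proof -
  let ?n = "hilbert_fun I d"
  obtain b where span: "\<forall>r\<in>forms d. \<exists>c. r \<approx> (\<Sum>k<?n. cst (c k) * b k)"
    using exists_basis[of d] by blast
  have "\<forall>i\<in>S. \<exists>c. e i \<approx> (\<Sum>k<?n. cst (c k) * b k)" using span e by blast
  from bchoice[OF this] obtain M where
    M: "\<And>i. i \<in> S \<Longrightarrow> e i \<approx> (\<Sum>k<?n. cst (M i k) * b k)" by blast
  have "\<exists>c. (\<exists>i\<in>S. c i \<noteq> 0) \<and> (\<forall>k\<in>{..<?n}. (\<Sum>i\<in>S. M i k * c i) = 0)"
    by (rule homogeneous_system_nontrivial) (use assms in auto)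
  then obtain c where c: "\<exists>i\<in>S. c i \<noteq> 0" "\<forall>k\<in>{..<?n}. (\<Sum>i\<in>S. M i k * c i) = 0"
    by blast
  have "(\<Sum>i\<in>S. cst (c i) * e i) \<approx> (\<Sum>i\<in>S. cst (c i) * (\<Sum>k<?n. cst (M i k) * b k))"
    by (intro eqv_sum eqv_mult eqv_refl M)
  also have "(\<Sum>i\<in>S. cst (c i) * (\<Sum>k<?n. cst (M i k) * b k)) =
      (\<Sum>k<?n. cst (\<Sum>i\<in>S. M i k * c i) * b k)"
    by (rule sum_cst_swap)
  also have "\<dots> = 0" using c(2) by simp
  finally have "(\<Sum>i\<in>S. cst (c i) * e i) \<in> I" by (simp add: eqv_def)
  with c(1) that show thesis by blast
qed

text \<open>
  A nontrivial relation would make one of the spanning elements superfluous. The remaining ones are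
  fewer than the members of a basis, so a system with more unknowns than equations produces a
  relation between basis elements.
\<close>

lemma spanning_imp_independent:
  assumes "finite S" and "hilbert_fun I d = card S"
    and span: "\<And>r. r \<in> forms d \<Longrightarrow> \<exists>c. r \<approx> (\<Sum>i\<in>S. cst (c i) * e i)"
    and rel: "(\<Sum>i\<in>S. cst (c i) * e i) \<in> I" and j: "j \<in> S"
  shows "c j = 0"
proof (rule ccontr)
  assume cj: "c j \<noteq> 0"
  let ?n = "hilbert_fun I d"
  obtain b where b: "\<forall>k<?n. b k \<in> forms d"
    and indep: "\<forall>c. (\<Sum>k<?n. cst (c k) * b k) \<in> I \<longrightarrow> (\<forall>k<?n. c k = 0)"
    using exists_basis[of d] by blast
  have "\<forall>k\<in>{..<?n}. \<exists>c. b k \<approx> (\<Sum>i\<in>S. cst (c i) * e i)" using span b by blast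
  from bchoice[OF this] obtain M where
    M: "\<And>k. k < ?n \<Longrightarrow> b k \<approx> (\<Sum>i\<in>S. cst (M k i) * e i)" by blast
  (* the relation eliminates \<open>e j\<close>, so the remaining elements span already *)
  define N where "N i k = M k i - M k j / c j * c i" for i k
  have N: "b k \<approx> (\<Sum>i\<in>S. cst (N i k) * e i)" if "k < ?n" for k
  proof -
    define t where "t = M k j / c j"
    have "(\<Sum>i\<in>S. cst (M k i) * e i) - (\<Sum>i\<in>S. cst (N i k) * e i) =
        cst t * (\<Sum>i\<in>S. cst (c i) * e i)"
      by (simp add: N_def t_def[symmetric] single_diff cst_mult sum_distrib_left algebra_simps flip: sum_subtractf)
    then have "(\<Sum>i\<in>S. cst (M k i) * e i) \<approx> (\<Sum>i\<in>S. cst (N i k) * e i)"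
      using rel by (simp add: eqv_def mult_mem)
    with M[OF that] show ?thesis by (rule eqv_trans)
  qed
  have "card (S - {j}) < card {..<?n}"
    using assms(1,2) j card_Diff1_less[of S j] by simp
  with assms(1) have "\<exists>x. (\<exists>k\<in>{..<?n}. x k \<noteq> 0) \<and> (\<forall>i\<in>S - {j}. (\<Sum>k<?n. N i k * x k) = 0)"
    by (intro homogeneous_system_nontrivial) auto
  then obtain x where x: "\<exists>k\<in>{..<?n}. x k \<noteq> 0" "\<forall>i\<in>S - {j}. (\<Sum>k<?n. N i k * x k) = 0"
    by blast
  have x': "(\<Sum>k<?n. N i k * x k) = 0" if "i \<in> S" for i
    using x(2) that cj by (cases "i = j") (auto simp: N_def)
  have "(\<Sum>k<?n. cst (x k) * b k) \<approx> (\<Sum>k<?n. cst (x k) * (\<Sum>i\<in>S. cst (N i k) * e i))"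
    by (intro eqv_sum eqv_mult eqv_refl N) simp
  also have "\<dots> = (\<Sum>i\<in>S. cst (\<Sum>k<?n. N i k * x k) * e i)"
    by (rule sum_cst_swap)
  also have "\<dots> = 0" using x' by simp
  finally have "(\<Sum>k<?n. cst (x k) * b k) \<in> I" by (simp add: eqv_def)
  with indep x(1) show False by auto
qed

text \<open>
  The second relation is found after removal of an index at which the first one does not vanish;
  this makes the two independent.
\<close>

lemma exists_two_relations:
  assumes "finite S" and "hilbert_fun I d + 1 < card S" and e: "\<And>i. i \<in> S \<Longrightarrow> e i \<in> forms d"
  shows "\<exists>c c'. (\<Sum>i\<in>S. cst (c i) * e i) \<in> I \<and> (\<Sum>i\<in>S. cst (c' i) * e i) \<in> I \<and>
    (\<forall>a b. (\<forall>i\<in>S. a * c i + b * c' i = 0) \<longrightarrow> a = 0 \<and> b = 0)"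
proof -
  obtain c j where c: "j \<in> S" "c j \<noteq> 0" "(\<Sum>i\<in>S. cst (c i) * e i) \<in> I"
  proof -
    have "hilbert_fun I d < card S" using assms(2) by simp
    from assms(1) this e obtain c where "\<exists>i\<in>S. c i \<noteq> 0" "(\<Sum>i\<in>S. cst (c i) * e i) \<in> I"
      by (rule exists_relation)
    with that show thesis by blast
  qed
  obtain c' k where c': "k \<in> S" "k \<noteq> j" "c' k \<noteq> 0" "(\<Sum>i\<in>S - {j}. cst (c' i) * e i) \<in> I"
  proof -
    have "hilbert_fun I d < card (S - {j})" using assms(1,2) c(1) by simp
    from exists_relation[OF _ this, of e] assms(1) e obtain c' where
      "\<exists>i\<in>S - {j}. c' i \<noteq> 0" "(\<Sum>i\<in>S - {j}. cst (c' i) * e i) \<in> I" by blast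
    with that show thesis by blast
  qed
  have "(\<Sum>i\<in>S. cst ((c'(j := 0)) i) * e i) = (\<Sum>i\<in>S - {j}. cst (c' i) * e i)"
    using c(1) assms(1) by (simp add: sum.remove)
  then have 2: "(\<Sum>i\<in>S. cst ((c'(j := 0)) i) * e i) \<in> I" using c'(4) by simp
  have "a = 0 \<and> b = 0" if "\<forall>i\<in>S. a * c i + b * (c'(j := 0)) i = 0" for a b
  proof -
    from that have "a * c j + b * (c'(j := 0)) j = 0" "a * c k + b * (c'(j := 0)) k = 0"
      using c(1) c'(1) by blast+
    then show ?thesis using c(2) c'(2,3) by simp
  qed
  with c(3) 2 show ?thesis by blast
qed

end

section \<open>Socle, duality and the reduction to one degree\<close>

context graded_quotient
begin

text \<open>
  An element killed by all linear forms is killed by the irrelevant ideal, so it lies in the socle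
  and thus in the socle degree. Graded pieces of different degrees meet only in zero.
\<close>

lemma socle_mem:
  assumes soc: "socle I \<subseteq> graded_piece I (socle_degree I)"
    and a: "a \<in> forms i" and i: "i \<noteq> socle_degree I"
    and ann: "\<And>l. l \<in> forms 1 \<Longrightarrow> l * a \<in> I"
  shows "a \<in> I"
proof -
  interpret A: cring A using ideal.quotient_is_cring[OF is_ideal cring_pol_ring] .
  define N where "N = coset ` {f. f * a \<in> I}"
  have "ideal {f. f * a \<in> I} R"
    by (rule ideal_pol_ringI) (auto simp: distrib_right add_mem mult.assoc mult_mem)
  then have "ideal N A"
    unfolding N_def by (rule ring.ring_ideal_imp_quot_ideal[OF ring_pol_ring is_ideal])
  moreover have "(\<Union>j\<in>{1..}. graded_piece I j) \<subseteq> N"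
  proof
    fix u assume "u \<in> (\<Union>j\<in>{1..}. graded_piece I j)"
    then obtain j f where f: "j \<ge> 1" "f \<in> forms j" "u = coset f" by (auto simp: graded_piece_def)
    have "j \<ge> 1 \<longrightarrow> f * a \<in> I"
      using f(2)
    proof (induction rule: form_induct)
      case (mult d l p)
      show ?case using mult_mem[OF ann[OF mult(1)], of p] by (simp add: mult_ac)
    qed (auto simp: distrib_right add_mem)
    then show "u \<in> N" using f by (auto simp: N_def)
  qed
  ultimately have "irrelevant_ideal I \<subseteq> N"
    unfolding irrelevant_ideal_def by (rule A.genideal_minimal)
  moreover have "b \<otimes>\<^bsub>A\<^esub> coset a = \<zero>\<^bsub>A\<^esub>" if "b \<in> N" for b
  proof -
    from that obtain f where "b = coset f" "f * a \<in> I" by (auto simp: N_def)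
    then show ?thesis by (simp add: coset_mult coset_eq_zero_iff)
  qed
  ultimately have "coset a \<in> socle I" unfolding socle_def by (auto simp: carrier_A)
  with soc obtain g where "g \<in> forms (socle_degree I)" "coset a = coset g"
    by (auto simp: graded_piece_def)
  then show "a \<in> I" using forms_eqv_mem[OF a _ i] by (simp add: coset_eq_iff)
qed

text \<open>
  As long as the degree is below the socle degree, a nonzero element can be multiplied by a linear
  form without becoming zero.
\<close>

lemma nonzero_pairing:
  assumes soc: "socle I \<subseteq> graded_piece I (socle_degree I)"
    and a: "a \<in> forms i" "a \<notin> I" and i: "i + j = socle_degree I"
  shows "\<exists>b\<in>forms j. a * b \<notin> I"
  using a i
proof (induction j arbitrary: a i)
  case 0
  then show ?case by (intro bexI[of _ 1]) (auto simp: forms_one)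
next
  case (Suc j)
  then obtain l where l: "l \<in> forms 1" "l * a \<notin> I"
    using socle_mem[OF soc Suc.prems(1)] by auto
  then obtain b where "b \<in> forms j" "l * a * b \<notin> I"
    using Suc.IH[OF forms_Suc_mult[OF l(1) Suc.prems(1)] l(2)] Suc.prems(3) by auto
  then show ?case using forms_Suc_mult[OF l(1)]
    by (intro bexI[of _ "l * b"]) (auto simp: mult_ac)
qed

text \<open>
  Maximal rank in the middle degree propagates upwards as surjectivity and, through the pairing into
  the socle, downwards as injectivity.
\<close>

lemma weak_lefschetzI:
  assumes soc: "socle I \<subseteq> graded_piece I (socle_degree I)" and sd: "socle_degree I = 2 * m + 1"
    and l: "l \<in> forms 1"
    and onto: "\<And>r. r \<in> forms (Suc m) \<Longrightarrow> \<exists>a\<in>forms m. r \<approx> l * a"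
  shows "weak_lefschetz I"
proof -
  have surj: "\<exists>a\<in>forms i. r \<approx> l * a" if "r \<in> forms (Suc i)" "m \<le> i" for r i
    using that(2,1)
  proof (induction i arbitrary: r rule: dec_induct)
    case base
    then show ?case using onto by blast
  next
    case (step i)
    have "d = Suc (Suc i) \<longrightarrow> (\<exists>a\<in>forms (Suc i). p \<approx> l * a)" if "p \<in> forms d" for p d
      using that
    proof (induction rule: form_induct)
      case (zero d)
      then show ?case by (auto intro!: bexI[of _ 0])
    next
      case (add d p q)
      show ?case
      proof
        assume "d = Suc (Suc i)"
        then obtain a b where "a \<in> forms (Suc i)" "p \<approx> l * a" "b \<in> forms (Suc i)" "q \<approx> l * b"
          using add by blast
        then show "\<exists>a\<in>forms (Suc i). p + q \<approx> l * a"
          by (intro bexI[of _ "a + b"]) (auto simp: distrib_left intro: eqv_add forms_add)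
      qed
    next
      case (mult d x p)
      show ?case
      proof
        assume "Suc d = Suc (Suc i)"
        then obtain a where a: "a \<in> forms i" "p \<approx> l * a" using step.IH mult by auto
        have "x * p \<approx> x * (l * a)" using a(2) by (intro eqv_mult eqv_refl)
        then show "\<exists>a\<in>forms (Suc i). x * p \<approx> l * a"
          using forms_Suc_mult[OF mult(1) a(1)]
          by (intro bexI[of _ "x * a"]) (simp_all add: mult_ac)
      qed
    qed simp
    then show ?case using step.prems by blast
  qed
  have inj: "a \<in> I" if a: "a \<in> forms i" "l * a \<in> I" and i: "i \<le> m" for a i
  proof (rule ccontr)
    assume "a \<notin> I"
    then obtain b where b: "b \<in> forms (Suc (2 * m - i))" "a * b \<notin> I"
      using nonzero_pairing[OF soc a(1), of "Suc (2 * m - i)"] sd i by auto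
    have "m \<le> 2 * m - i" using i by simp
    then obtain b' where "b \<approx> l * b'" using surj[OF b(1)] by blast
    then have "a * b \<approx> a * (l * b')" by (intro eqv_mult eqv_refl)
    moreover have "a * (l * b') \<in> I" using mult_mem[OF a(2), of b'] by (simp add: mult_ac)
    ultimately show False using b(2) eqv_mem_iff by blast
  qed
  show ?thesis unfolding weak_lefschetz_def
  proof (intro bexI allI)
    show "coset l \<in> graded_piece I 1" using l by (simp add: graded_piece_def)
    fix i
    show "inj_on (\<lambda>a. coset l \<otimes>\<^bsub>A\<^esub> a) (graded_piece I i) \<or>
      (\<lambda>a. coset l \<otimes>\<^bsub>A\<^esub> a) ` graded_piece I i = graded_piece I (i + 1)"
    proof (cases "i \<le> m")
      case True
      have "inj_on (\<lambda>a. coset l \<otimes>\<^bsub>A\<^esub> a) (graded_piece I i)"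
        using inj[OF forms_diff _ True]
        by (auto simp: inj_on_def graded_piece_def coset_mult coset_eq_iff eqv_def right_diff_distrib)
      then show ?thesis ..
    next
      case False
      have "(\<lambda>a. coset l \<otimes>\<^bsub>A\<^esub> a) ` graded_piece I i = graded_piece I (i + 1)"
      proof (intro equalityI subsetI)
        fix u assume "u \<in> graded_piece I (i + 1)"
        then obtain r where r: "r \<in> forms (Suc i)" "u = coset r" by (auto simp: graded_piece_def)
        with surj[OF r(1)] False obtain a where "a \<in> forms i" "r \<approx> l * a" by auto
        then show "u \<in> (\<lambda>a. coset l \<otimes>\<^bsub>A\<^esub> a) ` graded_piece I i"
          using r(2) by (auto simp: graded_piece_def coset_mult coset_eq_iff image_iff)
      next
        fix u assume "u \<in> (\<lambda>a. coset l \<otimes>\<^bsub>A\<^esub> a) ` graded_piece I i"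
        then show "u \<in> graded_piece I (i + 1)"
          using forms_Suc_mult[OF l] by (auto simp: graded_piece_def coset_mult)
      qed
      then show ?thesis ..
    qed
  qed
qed

end

text \<open>
  The zero ring has a zero socle.
\<close>

lemma gorenstein_imp_proper:
  assumes "homogeneous_ideal I" and "gorenstein I"
  shows "I \<noteq> UNIV"
proof
  assume UNIV: "I = UNIV"
  interpret ring pol_ring by (rule ring_pol_ring)
  have "ideal I pol_ring" by (simp add: UNIV ideal_pol_ringI)
  then interpret A: ring "quot_alg I" by (rule ideal.quotient_is_ring)
  have car: "carrier (quot_alg I) = {UNIV}"
  proof -
    have "(\<Union>h. {h + x}) = UNIV" for x :: "('a, 'b) pol"
    proof -
      have "y \<in> (\<Union>h. {h + x})" for y by (intro UN_I[of "y - x"]) simp_all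
      then show ?thesis by blast
    qed
    then show ?thesis by (auto simp: UNIV FactRing_def A_RCOSETS_def RCOSETS_def r_coset_def)
  qed
  from assms(2) have "A.dimension (Suc 0) (scalars I) (socle I)" by (simp add: gorenstein_def)
  then obtain v E where v: "v \<in> carrier (quot_alg I)" "v \<notin> E" "A.dimension 0 (scalars I) E"
    by (cases rule: A.dimension.cases) auto
  from v(3) have "E = {\<zero>\<^bsub>quot_alg I\<^esub>}" by (cases rule: A.dimension.cases) auto
  with v(1,2) car A.zero_closed show False by auto
qed

section \<open>Linear coordinates and ternary quadrics\<close>

text \<open>
  A change of coordinates is handled through the expansions that the new coordinates provide, not
  through the automorphism of \<open>R\<close> that they define.
\<close>

definition coordinates :: "('x::finite, 'k::field) pol \<Rightarrow> ('x, 'k) pol \<Rightarrow> ('x, 'k) pol \<Rightarrow> bool" where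
  "coordinates x y z \<longleftrightarrow> x \<in> forms 1 \<and> y \<in> forms 1 \<and> z \<in> forms 1 \<and>
     (\<forall>l\<in>forms 1. \<exists>a b c. l = cst a * x + cst b * y + cst c * z)"

lemma coordinates_permute:
  assumes "coordinates x y z"
  shows "coordinates y x z" and "coordinates x z y"
proof -
  have "cst a * x + cst b * y + cst c * z = cst b * y + cst a * x + cst c * z"
    and "cst a * x + cst b * y + cst c * z = cst a * x + cst c * z + cst b * y" for a b c
    by (simp_all add: ac_simps)
  with assms show "coordinates y x z" and "coordinates x z y"
    unfolding coordinates_def by metis+
qed

lemma coordinates_change:
  assumes "coordinates x y z" and "x' \<in> forms 1" "y' \<in> forms 1" "z' \<in> forms 1"
    and x: "x = cst a1 * x' + cst a2 * y' + cst a3 * z'"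
    and y: "y = cst b1 * x' + cst b2 * y' + cst b3 * z'"
    and z: "z = cst c1 * x' + cst c2 * y' + cst c3 * z'"
  shows "coordinates x' y' z'"
  unfolding coordinates_def
proof (intro conjI ballI)
  fix l :: "('a, 'b) pol" assume "l \<in> forms 1"
  with assms(1) obtain a b c where "l = cst a * x + cst b * y + cst c * z"
    by (auto simp: coordinates_def)
  then have "l = cst (a * a1 + b * b1 + c * c1) * x' + cst (a * a2 + b * b2 + c * c2) * y'
      + cst (a * a3 + b * b3 + c * c3) * z'"
    unfolding x y z by (simp add: cst_mult single_add algebra_simps)
  then show "\<exists>a b c. l = cst a * x' + cst b * y' + cst c * z'" by blast
qed (use assms in auto)

lemma coordinates_replace:
  assumes xyz: "coordinates x y z" and "a \<noteq> 0 \<or> b \<noteq> 0"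
  obtains v where "coordinates (cst a * x + cst b * y) v z" and "v = x \<or> v = y"
proof (cases "a = 0")
  case False
  have X: "x = cst (inverse a) * (cst a * x + cst b * y) + cst (- b / a) * y + cst 0 * z"
  proof -
    have "cst (- b / a) * y = - (cst (inverse a) * (cst b * y))"
      by (simp add: divide_inverse single_uminus cst_mult mult_ac)
    moreover have "cst (inverse a) * (cst a * x) = x"
      using False by (simp flip: mult.assoc cst_mult)
    ultimately show ?thesis by (simp add: distrib_left)
  qed
  then have "coordinates (cst a * x + cst b * y) y z"
    using xyz by (intro coordinates_change[OF xyz _ _ _ X, where ?b1.0 = 0 and ?b2.0 = 1 and ?b3.0 = 0
          and ?c1.0 = 0 and ?c2.0 = 0 and ?c3.0 = 1])
      (auto simp: coordinates_def intro!: forms_add forms_cst_mult)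
  with that show thesis by blast
next
  case True
  then have "b \<noteq> 0" using assms(2) by simp
  then have Y: "y = cst (inverse b) * (cst a * x + cst b * y) + cst 0 * x + cst 0 * z"
    using True by (simp flip: mult.assoc cst_mult)
  then have "coordinates (cst a * x + cst b * y) x z"
    using xyz by (intro coordinates_change[OF xyz _ _ _ _ Y, where ?a1.0 = 0 and ?a2.0 = 1 and ?a3.0 = 0
          and ?c1.0 = 0 and ?c2.0 = 0 and ?c3.0 = 1])
      (auto simp: coordinates_def intro!: forms_add forms_cst_mult)
  with that show thesis by blast
qed

lemma coordinates_variables:
  "coordinates (Poly_Mapping.single (Poly_Mapping.single 0 1) 1)
     (Poly_Mapping.single (Poly_Mapping.single 1 1) 1)
     (Poly_Mapping.single (Poly_Mapping.single 2 1) (1 :: 'k::field) :: (3, 'k) pol)"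
proof -
  let ?X = "\<lambda>j. Poly_Mapping.single (Poly_Mapping.single j 1) 1 :: (3, 'k) pol"
  have X: "?X j \<in> forms 1" for j
    by (simp add: forms_def mon_degree_def lookup_single when_def)
  have UNIV: "(UNIV :: 3 set) = {0, 1, 2}"
  proof -
    have "card {0, 1, 2 :: 3} = card (UNIV :: 3 set)" by simp
    then show ?thesis by (intro card_subset_eq[symmetric]) simp_all
  qed
  have "\<exists>a b c. l = cst a * ?X 0 + cst b * ?X 1 + cst c * ?X 2" if l: "l \<in> forms 1" for l
  proof -
    have "Poly_Mapping.lookup l t = Poly_Mapping.lookup (\<Sum>j\<in>{0, 1, 2}.
        cst (Poly_Mapping.lookup l (Poly_Mapping.single j 1)) * ?X j) t" for t
    proof (cases "mon_degree t = 1")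
      case True
      then have "(\<Sum>j\<in>UNIV. Poly_Mapping.lookup t j) = 1" by (simp add: mon_degree_def)
      then obtain j where j: "Poly_Mapping.lookup t j = 1" "\<forall>i. i \<noteq> j \<longrightarrow> Poly_Mapping.lookup t i = 0"
        using sum_eq_1_iff[of "UNIV :: 3 set" "Poly_Mapping.lookup t"] by auto
      have t: "t = Poly_Mapping.single j 1"
        by (rule poly_mapping_eqI) (use j in \<open>auto simp: lookup_single when_def\<close>)
      have eq: "Poly_Mapping.single i (1::nat) = Poly_Mapping.single j 1 \<longleftrightarrow> i = j" for i :: 3
        by (metis lookup_single_eq lookup_single_not_eq zero_neq_one)
      show ?thesis
        unfolding UNIV[symmetric] by (simp add: t lookup_sum mult_single lookup_single when_def eq[unfolded One_nat_def])
    next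
      case False
      then have "Poly_Mapping.lookup l t = 0" using l by (auto simp: forms_def in_keys_iff)
      moreover have "Poly_Mapping.single j (1::nat) \<noteq> t" for j :: 3
        using False by (auto simp: mon_degree_def lookup_single when_def)
      ultimately show ?thesis by (simp add: lookup_sum mult_single lookup_single when_def lookup_add)
    qed
    then have "l = (\<Sum>j\<in>{0, 1, 2}. cst (Poly_Mapping.lookup l (Poly_Mapping.single j 1)) * ?X j)"
      by (rule poly_mapping_eqI)
    then show ?thesis by (auto simp: add.assoc)
  qed
  then show ?thesis using X by (auto simp: coordinates_def)
qed

lemma binary_quadratic_factors:
  fixes a b c :: "'k::alg_closed_field"
  obtains \<alpha> \<beta> \<gamma> \<delta> where "\<And>x y :: ('x, 'k) pol. cst a * (x * x) + cst b * (x * y) + cst c * (y * y) =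
    (cst \<alpha> * x + cst \<beta> * y) * (cst \<gamma> * x + cst \<delta> * y)"
proof -
  have expand: "(cst \<alpha> * x + cst \<beta> * y) * (cst \<gamma> * x + cst \<delta> * y) =
      cst (\<alpha> * \<gamma>) * (x * x) + cst (\<alpha> * \<delta> + \<beta> * \<gamma>) * (x * y) + cst (\<beta> * \<delta>) * (y * y)"
    for x y :: "('x, 'k) pol" and \<alpha> \<beta> \<gamma> \<delta>
    by (simp add: cst_mult single_add algebra_simps)
  show thesis
  proof (cases "a = 0")
    case True
    show thesis by (rule that[of 0 1 b c]) (simp only: expand, simp add: True)
  next
    case False
    then obtain r where "poly [:c, b, a:] r = 0"
      using alg_closed_imp_poly_has_root[of "[:c, b, a:]"] by auto
    then have "c = - r * (b + a * r)" by (simp add: algebra_simps eq_neg_iff_add_eq_0)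
    then show thesis by (intro that[of 1 "- r" a "b + a * r"]) (simp only: expand, simp)
  qed
qed

text \<open>
  A form of degree two lies in the square of the irrelevant ideal.
\<close>

lemma linear_times_forms:
  assumes xyz: "coordinates x y z" and q: "q \<in> forms 2"
  obtains l1 l2 l3 where "l1 \<in> forms 1" "l2 \<in> forms 1" "l3 \<in> forms 1" "q = x * l1 + y * l2 + z * l3"
proof -
  have "d = 2 \<longrightarrow> (\<exists>l1\<in>forms 1. \<exists>l2\<in>forms 1. \<exists>l3\<in>forms 1. p = x * l1 + y * l2 + z * l3)"
    if "p \<in> forms d" for p d
    using that
  proof (induction rule: form_induct)
    case (zero d)
    show ?case by (auto intro!: bexI[of _ 0])
  next
    case (add d p p')
    show ?case
    proof
      assume "d = 2"
      with add obtain l1 l2 l3 m1 m2 m3 where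
        "l1 \<in> forms 1" "l2 \<in> forms 1" "l3 \<in> forms 1" "p = x * l1 + y * l2 + z * l3"
        "m1 \<in> forms 1" "m2 \<in> forms 1" "m3 \<in> forms 1" "p' = x * m1 + y * m2 + z * m3" by blast
      then show "\<exists>l1\<in>forms 1. \<exists>l2\<in>forms 1. \<exists>l3\<in>forms 1. p + p' = x * l1 + y * l2 + z * l3"
        by - (rule bexI[of _ "l1 + m1"], rule bexI[of _ "l2 + m2"], rule bexI[of _ "l3 + m3"],
          simp_all add: forms_add, simp add: algebra_simps)
    qed
  next
    case (mult d l p)
    show ?case
    proof
      assume "Suc d = 2"
      then have p: "p \<in> forms 1" using mult(2) by simp
      obtain a b c where "l = cst a * x + cst b * y + cst c * z"
        using xyz mult(1) unfolding coordinates_def by blast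
      then show "\<exists>l1\<in>forms 1. \<exists>l2\<in>forms 1. \<exists>l3\<in>forms 1. l * p = x * l1 + y * l2 + z * l3"
        using p by - (rule bexI[of _ "cst a * p"], rule bexI[of _ "cst b * p"],
          rule bexI[of _ "cst c * p"], simp_all add: forms_cst_mult, simp add: algebra_simps)
    qed
  qed simp
  with q that show thesis by blast
qed

text \<open>
  The restriction of the quadric to the line \<open>y = 0\<close> is a binary form and has a linear factor \<open>u\<close>.
  So the quadric vanishes at the point \<open>u = y = 0\<close>, that is, it lies in the ideal \<open>(u, y)\<close>.
\<close>

lemma quadric_contains_point:
  fixes q :: "('x::finite, 'k::alg_closed_field) pol"
  assumes xyz: "coordinates x y z" and q: "q \<in> forms 2"
  obtains u v L M where "coordinates u y v" "L \<in> forms 1" "M \<in> forms 1" "q = u * L + y * M"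
proof -
  obtain l1 l2 l3 where l: "l1 \<in> forms 1" "l2 \<in> forms 1" "l3 \<in> forms 1"
    and q_eq: "q = x * l1 + y * l2 + z * l3"
    using linear_times_forms[OF xyz q] .
  obtain a1 a2 a3 where l1: "l1 = cst a1 * x + cst a2 * y + cst a3 * z"
    using xyz l(1) unfolding coordinates_def by blast
  obtain c1 c2 c3 where l3: "l3 = cst c1 * x + cst c2 * y + cst c3 * z"
    using xyz l(3) unfolding coordinates_def by blast
  define M where "M = l2 + cst a2 * x + cst c2 * z"
  have M: "M \<in> forms 1" using xyz l(2) by (auto simp: M_def coordinates_def intro!: forms_add forms_cst_mult)
  have q2: "q = cst a1 * (x * x) + cst (a3 + c1) * (x * z) + cst c3 * (z * z) + y * M"
    by (simp add: q_eq l1 l3 M_def single_add algebra_simps)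
  obtain \<alpha> \<beta> \<gamma> \<delta> where "cst a1 * (x * x) + cst (a3 + c1) * (x * z) + cst c3 * (z * z) =
      (cst \<alpha> * x + cst \<beta> * z) * (cst \<gamma> * x + cst \<delta> * z)"
    using binary_quadratic_factors[where 'x = 'x and a = a1 and b = "a3 + c1" and c = c3] by metis
  with q2 have q3: "q = (cst \<alpha> * x + cst \<beta> * z) * (cst \<gamma> * x + cst \<delta> * z) + y * M" by simp
  have L: "cst \<gamma> * x + cst \<delta> * z \<in> forms 1"
    using xyz by (auto simp: coordinates_def intro!: forms_add forms_cst_mult)
  show thesis
  proof (cases "\<alpha> \<noteq> 0 \<or> \<beta> \<noteq> 0")
    case True
    then obtain v where "coordinates (cst \<alpha> * x + cst \<beta> * z) v y"
      using coordinates_replace[OF coordinates_permute(2)[OF xyz]] by blast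
    from that[OF coordinates_permute(2)[OF this] L M q3] show thesis .
  next
    case False
    with q3 have "q = x * 0 + y * M" by simp
    from that[OF xyz forms_zero M this] show thesis .
  qed
qed

text \<open>
  The gradient of the quadric at the point \<open>u = y = 0\<close> is \<open>c u + c' y\<close>, which is nonzero because
  \<open>c \<noteq> 0\<close>. This tangent becomes the first coordinate, and the remaining terms divisible by it are
  absorbed into the third one.
\<close>

lemma quadric_smooth_point:
  fixes u y v :: "('x::finite, 'k::field) pol"
  assumes uyv: "coordinates u y v" and c: "c \<noteq> 0"
    and q: "q = u * (cst a * u + cst b * y + cst c * v) + y * (cst a' * u + cst b' * y + cst c' * v)"
  shows "\<exists>x z k. coordinates x y z \<and> q = x * z - cst k * y\<^sup>2"
proof -
  (* u expressed through the new coordinate x *)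
  define e f where "e = inverse c" and "f = - (c' * e)"
  define x where "x = cst c * u + cst c' * y"
  have "cst e * x = cst (c * e) * u - cst f * y"
    by (simp add: x_def f_def cst_hom algebra_simps)
  moreover have "c * e = 1" using c by (simp add: e_def)
  ultimately have u: "u = cst e * x + cst f * y" by simp
  define N where "N = cst (a * e * e) * x + cst (2 * a * e * f + (b + a') * e) * y"
  define z where "z = v + N"
  define k where "k = - (a * f * f + (b + a') * f + b')"
  have v: "v = z - N" by (simp add: z_def)
  have forms: "x \<in> forms 1" "y \<in> forms 1" "z \<in> forms 1"
    using uyv by (auto simp: x_def z_def N_def coordinates_def intro!: forms_add forms_cst_mult)
  have "coordinates x y z"
  proof (rule coordinates_change[OF uyv forms])
    show "u = cst e * x + cst f * y + cst 0 * z" using u by simp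
    show "y = cst 0 * x + cst 1 * y + cst 0 * z" by simp
    show "v = cst (- (a * e * e)) * x + cst (- (2 * a * e * f + (b + a') * e)) * y + cst 1 * z"
      by (simp add: v N_def cst_hom algebra_simps)
  qed
  moreover have "q = x * z - cst k * y\<^sup>2"
  proof -
    have "q = v * x + (cst a * (u * u) + cst (b + a') * (u * y) + cst b' * (y * y))"
      by (simp add: q x_def single_add algebra_simps)
    also have "cst a * (u * u) + cst (b + a') * (u * y) + cst b' * (y * y) = N * x - cst k * y\<^sup>2"
      unfolding u
      by (simp add: N_def k_def cst_hom power2_eq_square algebra_simps)
    finally show ?thesis by (simp add: z_def algebra_simps)
  qed
  ultimately show ?thesis by blast
qed

text \<open>
  A quadric that is singular at the point provided by \<open>quadric_contains_point\<close> is a binary form in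
  the two coordinates that vanish there. It splits into two linear factors, which are either
  independent (a conic with \<open>c = 0\<close>) or proportional (a double line).
\<close>

lemma quadric_normal_form:
  fixes x0 y0 z0 q :: "('x::finite, 'k::alg_closed_field) pol"
  assumes "coordinates x0 y0 z0" and "q \<in> forms 2" and "q \<noteq> 0"
  obtains (conic) x y z c where "coordinates x y z" "q = x * z - cst c * y\<^sup>2"
  | (double_line) x y z k where "coordinates x y z" "k \<noteq> 0" "q = cst k * x\<^sup>2"
proof -
  obtain u v L M where uyv: "coordinates u y0 v" and LM: "L \<in> forms 1" "M \<in> forms 1"
    and q: "q = u * L + y0 * M"
    using quadric_contains_point[OF assms(1,2)] .
  obtain a b c where L: "L = cst a * u + cst b * y0 + cst c * v"
    using uyv LM(1) unfolding coordinates_def by blast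
  obtain a' b' c' where M: "M = cst a' * u + cst b' * y0 + cst c' * v"
    using uyv LM(2) unfolding coordinates_def by blast
  consider "c \<noteq> 0" | "c' \<noteq> 0" | "c = 0" "c' = 0" by blast
  then show thesis
  proof cases
    case 1
    then show thesis using quadric_smooth_point[OF uyv 1 q[unfolded L M]] conic by blast
  next
    case 2
    have "q = y0 * (cst b' * y0 + cst a' * u + cst c' * v) + u * (cst b * y0 + cst a * u + cst c * v)"
      by (simp add: q L M algebra_simps)
    then show thesis
      using quadric_smooth_point[OF coordinates_permute(1)[OF uyv] 2] conic by blast
  next
    case 3
    obtain \<alpha> \<beta> \<gamma> \<delta> where "cst a * (u * u) + cst (b + a') * (u * y0) + cst b' * (y0 * y0) =
        (cst \<alpha> * u + cst \<beta> * y0) * (cst \<gamma> * u + cst \<delta> * y0)"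
      using binary_quadratic_factors[where 'x = 'x and a = a and b = "b + a'" and c = b'] by metis
    then have q2: "q = (cst \<alpha> * u + cst \<beta> * y0) * (cst \<gamma> * u + cst \<delta> * y0)"
      using 3 by (simp add: q L M single_add algebra_simps)
    define x z where "x = cst \<alpha> * u + cst \<beta> * y0" and "z = cst \<gamma> * u + cst \<delta> * y0"
    define D where "D = \<alpha> * \<delta> - \<beta> * \<gamma>"
    show thesis
    proof (cases "D = 0")
      case False
      have "coordinates x v z"
      proof (rule coordinates_change[OF uyv])
        have "cst \<delta> * x - cst \<beta> * z = cst D * u" "cst \<alpha> * z - cst \<gamma> * x = cst D * y0"
          by (simp_all add: x_def z_def D_def single_diff cst_mult algebra_simps)
        then have "cst (inverse D) * (cst \<delta> * x - cst \<beta> * z) = u"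
            "cst (inverse D) * (cst \<alpha> * z - cst \<gamma> * x) = y0"
          using False by (simp_all flip: mult.assoc cst_mult)
        then show "u = cst (inverse D * \<delta>) * x + cst 0 * v + cst (- (inverse D * \<beta>)) * z"
          "y0 = cst (- (inverse D * \<gamma>)) * x + cst 0 * v + cst (inverse D * \<alpha>) * z"
          by (simp_all add: cst_mult single_uminus algebra_simps)
        show "v = cst 0 * x + cst 1 * v + cst 0 * z" by simp
      qed (use uyv in \<open>auto simp: x_def z_def coordinates_def intro!: forms_add forms_cst_mult\<close>)
      moreover have "q = x * z - cst 0 * v\<^sup>2" by (simp add: q2 x_def z_def)
      ultimately show thesis by (rule conic)
    next
      case True
      have "x \<noteq> 0" "z \<noteq> 0" using q2 assms(3) by (auto simp: x_def z_def)
      then have ne: "\<alpha> \<noteq> 0 \<or> \<beta> \<noteq> 0" "\<gamma> \<noteq> 0 \<or> \<delta> \<noteq> 0" by (auto simp: x_def z_def)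
      obtain k where k: "\<gamma> = k * \<alpha>" "\<delta> = k * \<beta>"
      proof (cases "\<alpha> = 0")
        case True
        then have "\<gamma> = \<delta> / \<beta> * \<alpha>" "\<delta> = \<delta> / \<beta> * \<beta>"
          using ne \<open>D = 0\<close> by (auto simp: D_def)
        then show thesis by (rule that)
      next
        case False
        then have "\<gamma> = \<gamma> / \<alpha> * \<alpha>" "\<delta> = \<gamma> / \<alpha> * \<beta>"
          using \<open>D = 0\<close> by (auto simp: D_def field_simps)
        then show thesis by (rule that)
      qed
      have "q = cst k * x\<^sup>2"
        by (simp add: q2 x_def k cst_mult power2_eq_square algebra_simps)
      moreover have "k \<noteq> 0" using ne k by auto
      moreover obtain w where "coordinates x w v"
        using coordinates_replace[OF uyv ne(1)] unfolding x_def by blast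
      ultimately show thesis using double_line by blast
    qed
  qed
qed

section \<open>Binary forms annihilated by a linear form\<close>

text \<open>
  The homogenization of \<open>P\<close> in degree \<open>d\<close>, evaluated at \<open>y\<close> and \<open>z\<close>. Coefficients of \<open>P\<close> beyond
  \<open>d\<close> are ignored. This way the arithmetic of binary forms is that of univariate polynomials.
\<close>

definition binary_form :: "nat \<Rightarrow> 'k::field poly \<Rightarrow> ('x, 'k) pol \<Rightarrow> ('x, 'k) pol \<Rightarrow> ('x, 'k) pol" where
  "binary_form d P y z = (\<Sum>i\<le>d. cst (coeff P i) * (y ^ i * z ^ (d - i)))"

lemma binary_form_add: "binary_form d (P + Q) y z = binary_form d P y z + binary_form d Q y z"
  by (simp add: binary_form_def single_add distrib_right sum.distrib)

lemma binary_form_smult: "binary_form d (smult a P) y z = cst a * binary_form d P y z"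
  by (simp add: binary_form_def cst_mult sum_distrib_left mult.assoc)

lemma binary_form_monom: "k \<le> d \<Longrightarrow> binary_form d (monom 1 k) y z = y ^ k * z ^ (d - k)"
proof -
  assume k: "k \<le> d"
  have "binary_form d (monom 1 k) y z = (\<Sum>i\<le>d. if i = k then y ^ i * z ^ (d - i) else 0)"
    unfolding binary_form_def by (rule sum.cong) auto
  then show ?thesis using k by simp
qed

lemma forms_monomial: "y \<in> forms 1 \<Longrightarrow> z \<in> forms 1 \<Longrightarrow> y ^ i * z ^ j \<in> forms (i + j)"
  by (intro forms_mult forms_power)

lemma forms_binary_form: "y \<in> forms 1 \<Longrightarrow> z \<in> forms 1 \<Longrightarrow> binary_form d P y z \<in> forms d"
  unfolding binary_form_def
  by (intro forms_sum forms_cst_mult) (metis atMost_iff forms_monomial le_add_diff_inverse)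

lemma binary_form_times_second:
  assumes "Polynomial.degree P \<le> d"
  shows "z * binary_form d P y z = binary_form (Suc d) P y z"
proof -
  have "binary_form (Suc d) P y z = (\<Sum>i\<le>d. cst (coeff P i) * (y ^ i * z ^ (Suc d - i)))"
    using assms by (simp add: binary_form_def coeff_eq_0)
  also have "\<dots> = (\<Sum>i\<le>d. z * (cst (coeff P i) * (y ^ i * z ^ (d - i))))"
    by (intro sum.cong) (auto simp: Suc_diff_le algebra_simps)
  finally show ?thesis by (simp add: binary_form_def sum_distrib_left)
qed

lemma binary_form_times_first: "y * binary_form d P y z = binary_form (Suc d) (pCons 0 P) y z"
proof -
  have "binary_form (Suc d) (pCons 0 P) y z =
      (\<Sum>i\<le>d. cst (coeff P i) * (y ^ Suc i * z ^ (d - i)))"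
    by (simp add: binary_form_def sum.atMost_Suc_shift del: sum.atMost_Suc)
  then show ?thesis by (simp add: binary_form_def sum_distrib_left mult_ac)
qed

context graded_quotient
begin

text \<open>
  As \<open>w\<close> kills \<open>x\<close>, only the monomials in \<open>y\<close> and \<open>z\<close> survive multiplication by \<open>w\<close>.
\<close>

lemma form_times_annihilated:
  assumes xyz: "coordinates x y z" and wx: "w * x \<in> I" and r: "r \<in> forms d"
  shows "\<exists>P. Polynomial.degree P \<le> d \<and> w * r \<approx> w * binary_form d P y z"
  using r
proof (induction rule: form_induct)
  case (const c)
  show ?case by (intro exI[of _ "[:c:]"]) (simp add: binary_form_def)
next
  case (zero d)
  show ?case by (intro exI[of _ 0]) (simp add: binary_form_def)
next
  case (add d p q)
  then obtain P Q where "Polynomial.degree P \<le> d" "w * p \<approx> w * binary_form d P y z"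
    "Polynomial.degree Q \<le> d" "w * q \<approx> w * binary_form d Q y z" by blast
  then show ?case
    by (intro exI[of _ "P + Q"])
      (auto simp: binary_form_add distrib_left intro: degree_add_le eqv_add)
next
  case (mult d l p)
  then obtain P where P: "Polynomial.degree P \<le> d" "w * p \<approx> w * binary_form d P y z" by blast
  obtain a b c where l: "l = cst a * x + cst b * y + cst c * z"
    using xyz mult(1) unfolding coordinates_def by blast
  have "w * (l * p) = cst a * p * (w * x) + (cst b * y + cst c * z) * (w * p)"
    by (simp add: l algebra_simps)
  also have "\<dots> \<approx> 0 + (cst b * y + cst c * z) * (w * binary_form d P y z)"
    using mult_mem[OF wx] by (intro eqv_add eqv_mult eqv_refl P(2)) (simp add: eqv_def)
  also have "0 + (cst b * y + cst c * z) * (w * binary_form d P y z) =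
      w * (cst b * (y * binary_form d P y z) + cst c * (z * binary_form d P y z))"
    by (simp add: algebra_simps)
  also have "\<dots> = w * binary_form (Suc d) (smult b (pCons 0 P) + smult c P) y z"
    by (simp only: binary_form_times_first binary_form_times_second[OF P(1)] binary_form_add
        binary_form_smult)
  finally show ?case
    using P(1) by (intro exI[of _ "smult b (pCons 0 P) + smult c P"] conjI degree_add_le)
      (auto intro: order_trans[OF degree_smult_le] order_trans[OF degree_pCons_le])
qed

lemma exists_functional:
  assumes "hilbert_fun I d = 1"
  shows "\<exists>\<omega>. \<forall>r\<in>forms d. \<exists>c. r \<approx> cst c * \<omega>"
proof -
  obtain b where b: "\<forall>r\<in>forms d. \<exists>c. r \<approx> (\<Sum>k<hilbert_fun I d. cst (c k) * b k)"
    using exists_basis[of d] by blast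
  have "\<exists>c. r \<approx> cst c * b 0" if "r \<in> forms d" for r
  proof -
    from b that obtain c where "r \<approx> (\<Sum>k<hilbert_fun I d. cst (c k) * b k)" by blast
    then have "r \<approx> cst (c 0) * b 0" by (simp add: assms)
    then show ?thesis ..
  qed
  then show ?thesis by blast
qed

text \<open>
  Suppose that \<open>F\<close> and \<open>G\<close> are independent; let them have distinct degrees. The binary forms of
  degree \<open>m+1\<close> killed by \<open>w\<close> contain all multiples of \<open>F\<close> and \<open>G\<close> by the variables, and among
  the dehomogenized multiples three different degrees occur: \<open>degree F\<close>, \<open>degree G\<close> and
  \<open>degree G + 1\<close>. Together with the \<open>m-1\<close> monomials of the other degrees they span the binary forms
  of degree \<open>m+1\<close>. Since \<open>A\<close> has dimension one in its socle degree, a binary form \<open>p\<close> of degree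
  \<open>m-1\<close>, which has \<open>m\<close> coefficients, has to satisfy only \<open>m-1\<close> linear conditions for \<open>w p\<close> to
  annihilate these monomials. A nonzero solution gives a nonzero element \<open>w p\<close> of degree \<open>m\<close> that
  annihilates all forms of degree \<open>m+1\<close>, contrary to the duality of \<open>A\<close>.
\<close>

lemma annihilated_binary_forms_dependent:
  assumes soc: "socle I \<subseteq> graded_piece I (socle_degree I)" and sd: "socle_degree I = 2 * m + 1"
    and top: "hilbert_fun I (2 * m + 1) = 1" and m: "m \<ge> 1"
    and xyz: "coordinates x y z" and w: "w \<in> forms 1" and wx: "w * x \<in> I"
    and faithful: "\<And>P. Polynomial.degree P \<le> m - 1 \<Longrightarrow> w * binary_form (m - 1) P y z \<in> I \<Longrightarrow> P = 0"
    and F: "Polynomial.degree F \<le> m" "w * binary_form m F y z \<in> I"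
    and G: "Polynomial.degree G \<le> m" "w * binary_form m G y z \<in> I"
  shows "\<not> lin_indep2 F G"
proof
  assume "lin_indep2 F G"
  then obtain a b c d where uv: "smult a F + smult b G \<noteq> 0" "smult c F + smult d G \<noteq> 0"
    "Polynomial.degree (smult a F + smult b G) < Polynomial.degree (smult c F + smult d G)"
    by (rule lin_indep2_distinct_degrees)
  have comb: "Polynomial.degree (smult a F + smult b G) \<le> m"
    "w * binary_form m (smult a F + smult b G) y z \<in> I" for a b
  proof -
    show "Polynomial.degree (smult a F + smult b G) \<le> m"
      using F(1) G(1) by (auto intro!: degree_add_le order_trans[OF degree_smult_le])
    have "w * binary_form m (smult a F + smult b G) y z =
        cst a * (w * binary_form m F y z) + cst b * (w * binary_form m G y z)"
      by (simp add: binary_form_add binary_form_smult algebra_simps)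
    then show "w * binary_form m (smult a F + smult b G) y z \<in> I"
      using F(2) G(2) by (simp add: add_mem mult_mem)
  qed
  define u v where "u = smult a F + smult b G" and "v = smult c F + smult d G"
  have u: "u \<noteq> 0" "Polynomial.degree u \<le> m" "w * binary_form m u y z \<in> I"
    and v: "v \<noteq> 0" "Polynomial.degree v \<le> m" "w * binary_form m v y z \<in> I"
    and less: "Polynomial.degree u < Polynomial.degree v"
    using uv comb by (simp_all add: u_def v_def)
  (* degrees of the dehomogenizations of z u, z v and y v *)
  define D where "D = {Polynomial.degree u, Polynomial.degree v, Suc (Polynomial.degree v)}"
  have y: "y \<in> forms 1" and z: "z \<in> forms 1" using xyz by (auto simp: coordinates_def)
  (* taking the coefficient of \<open>\<omega>\<close> identifies the piece of A in the socle degree with the field *)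
  obtain \<omega> where \<omega>: "\<forall>r\<in>forms (2 * m + 1). \<exists>c. r \<approx> cst c * \<omega>"
    using exists_functional[OF top] by blast
  define mon where "mon k j = w * (y ^ j * z ^ (m - 1 - j)) * (y ^ k * z ^ (Suc m - k))" for k j
  have "mon k j \<in> forms (2 * m + 1)" if "k \<le> Suc m" "j < m" for k j
  proof -
    have "mon k j \<in> forms (1 + (j + (m - 1 - j)) + (k + (Suc m - k)))"
      unfolding mon_def by (intro forms_mult w forms_monomial y z)
    moreover have "1 + (j + (m - 1 - j)) + (k + (Suc m - k)) = 2 * m + 1" using that by simp
    ultimately show ?thesis by (simp only:)
  qed
  then have "\<forall>k j. \<exists>c. k \<le> Suc m \<and> j < m \<longrightarrow> mon k j \<approx> cst c * \<omega>" using \<omega> by blast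
  then obtain M where M: "\<And>k j. k \<le> Suc m \<Longrightarrow> j < m \<Longrightarrow> mon k j \<approx> cst (M k j) * \<omega>" by metis
  have "card ({..Suc m} - D) < card {..<m}"
  proof -
    have "D \<subseteq> {..Suc m}" "card D = 3" using u v less by (auto simp: D_def)
    then show ?thesis using m by (simp add: card_Diff_subset finite_subset)
  qed
  then have "\<exists>c. (\<exists>j\<in>{..<m}. c j \<noteq> 0) \<and> (\<forall>k\<in>{..Suc m} - D. (\<Sum>j<m. M k j * c j) = 0)"
    by (intro homogeneous_system_nontrivial) auto
  then obtain c where c: "\<exists>j\<in>{..<m}. c j \<noteq> 0" "\<forall>k\<in>{..Suc m} - D. (\<Sum>j<m. M k j * c j) = 0"
    by blast
  define p where "p = (\<Sum>j<m. monom (c j) j)"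
  have coeff_p: "coeff p j = (if j < m then c j else 0)" for j
    by (simp add: p_def coeff_sum)
  then have "p \<noteq> 0" using c(1) by (metis coeff_0 lessThan_iff)
  have deg_p: "Polynomial.degree p \<le> m - 1"
    using coeff_p m by (intro degree_le) auto
  define g where "g = w * binary_form (m - 1) p y z"
  have g: "g \<in> forms m"
    using forms_Suc_mult[OF w forms_binary_form[OF y z], of "m - 1" p] m by (simp add: g_def)
  have "g \<notin> I" using faithful[OF deg_p] \<open>p \<noteq> 0\<close> by (auto simp: g_def)
  have span: "g * binary_form (Suc m) P y z \<in> I" if "Polynomial.degree P \<le> Suc m" for P
  proof -
    (* a triangular system: one polynomial of each degree suffices to reach all of them *)
    have has_degree: "\<exists>Q. Q \<noteq> 0 \<and> Polynomial.degree Q = k \<and> g * binary_form (Suc m) Q y z \<in> I"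
      if k: "k \<le> Suc m" for k
    proof -
      have times: "g * binary_form (Suc m) Q y z \<in> I"
        if "binary_form (Suc m) Q y z = l * binary_form m Q' y z" "w * binary_form m Q' y z \<in> I" for Q Q' l
      proof -
        have "g * binary_form (Suc m) Q y z = binary_form (m - 1) p y z * l * (w * binary_form m Q' y z)"
          by (simp add: g_def that(1) mult_ac)
        then show ?thesis using mult_mem[OF that(2)] by simp
      qed
      consider "k \<notin> D" | "k = Polynomial.degree u" | "k = Polynomial.degree v" | "k = Suc (Polynomial.degree v)"
        by (auto simp: D_def)
      then show ?thesis
      proof cases
        case 1
        have "g * binary_form (Suc m) (monom 1 k) y z = (\<Sum>j<m. cst (c j) * mon k j)"
        proof -
          have "{..m - 1} = {..<m}" using m by auto
          then have "binary_form (m - 1) p y z = (\<Sum>j<m. cst (c j) * (y ^ j * z ^ (m - 1 - j)))"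
            by (auto simp: binary_form_def coeff_p intro!: sum.cong)
          then show ?thesis
            by (simp add: g_def binary_form_monom[OF k] mon_def sum_distrib_left sum_distrib_right mult_ac)
        qed
        also have "\<dots> \<approx> (\<Sum>j<m. cst (c j) * (cst (M k j) * \<omega>))"
          using M k by (intro eqv_sum eqv_mult eqv_refl) auto
        also have "\<dots> = cst (\<Sum>j<m. M k j * c j) * \<omega>"
          by (simp add: cst_sum sum_distrib_left cst_mult mult_ac)
        also have "\<dots> = 0" using c(2) 1 k by simp
        finally have "g * binary_form (Suc m) (monom 1 k) y z \<in> I" by (simp add: eqv_def)
        then show ?thesis by (intro exI[of _ "monom 1 k"]) (simp add: degree_monom_eq)
      next
        case 2
        then show ?thesis using times[OF binary_form_times_second[OF u(2), symmetric] u(3)] u(1) by blast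
      next
        case 3
        then show ?thesis using times[OF binary_form_times_second[OF v(2), symmetric] v(3)] v(1) by blast
      next
        case 4
        then show ?thesis using times[OF binary_form_times_first[symmetric] v(3)] v(1)
          by (intro exI[of _ "pCons 0 v"]) simp
      qed
    qed
    show ?thesis using that
    proof (induction "Polynomial.degree P" arbitrary: P rule: less_induct)
      case less
      show ?case
      proof (cases "P = 0")
        case False
        obtain Q where Q: "Q \<noteq> 0" "Polynomial.degree Q = Polynomial.degree P"
          "g * binary_form (Suc m) Q y z \<in> I" using has_degree[OF less.prems] by blast
        define t where "t = lead_coeff P / lead_coeff Q"
        define P' where "P' = P - smult t Q"
        have P: "P = P' + smult t Q" by (simp add: P'_def)
        have "g * binary_form (Suc m) P' y z \<in> I"
        proof (cases "P' = 0")
          case False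
          have "coeff Q (Polynomial.degree P) \<noteq> 0" using Q(1,2) by (metis leading_coeff_0_iff)
          then have "coeff P' (Polynomial.degree P) = 0" by (simp add: P'_def t_def Q(2))
          moreover have "Polynomial.degree P' \<le> Polynomial.degree P" unfolding P'_def
            using Q(2) by (intro degree_diff_le) (auto intro: order_trans[OF degree_smult_le])
          ultimately have "Polynomial.degree P' < Polynomial.degree P"
            using False by (metis le_neq_implies_less leading_coeff_0_iff)
          with less show ?thesis by simp
        qed (simp add: binary_form_def)
        moreover have "g * binary_form (Suc m) P y z =
            g * binary_form (Suc m) P' y z + cst t * (g * binary_form (Suc m) Q y z)"
          unfolding P by (simp add: binary_form_add binary_form_smult algebra_simps)
        ultimately show ?thesis using add_mem mult_mem[OF Q(3)] by simp
      qed (simp add: binary_form_def)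
    qed
  qed
  obtain r where r: "r \<in> forms (Suc m)" "g * r \<notin> I"
    using nonzero_pairing[OF soc g \<open>g \<notin> I\<close>, of "Suc m"] sd by auto
  obtain P where P: "Polynomial.degree P \<le> Suc m" "w * r \<approx> w * binary_form (Suc m) P y z"
    using form_times_annihilated[OF xyz wx r(1)] by blast
  have "g * r = binary_form (m - 1) p y z * (w * r)" by (simp add: g_def mult_ac)
  also have "\<dots> \<approx> binary_form (m - 1) p y z * (w * binary_form (Suc m) P y z)"
    by (intro eqv_mult eqv_refl P(2))
  also have "\<dots> = g * binary_form (Suc m) P y z" by (simp add: g_def mult_ac)
  finally show False using span[OF P(1)] r(2) eqv_mem_iff by blast
qed

end

section \<open>Monomials that span the forms modulo a conic\<close>

text \<open>
  Linear combinations of two families with \<open>d+1\<close> and \<open>d\<close> members. The coefficients are packed into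
  polynomials because the restrictions to a line below are most easily described by them.
\<close>

definition two_family :: "nat \<Rightarrow> (nat \<Rightarrow> ('x, 'k::field) pol) \<Rightarrow> (nat \<Rightarrow> ('x, 'k) pol) \<Rightarrow> 'k poly \<Rightarrow> 'k poly \<Rightarrow> ('x, 'k) pol" where
  "two_family d e e' P Q = (\<Sum>i\<le>d. cst (coeff P i) * e i) + (\<Sum>i<d. cst (coeff Q i) * e' i)"

lemma two_family_add:
  "two_family d e e' (P + P') (Q + Q') = two_family d e e' P Q + two_family d e e' P' Q'"
  by (simp add: two_family_def single_add distrib_right sum.distrib algebra_simps)

lemma two_family_smult:
  "two_family d e e' (smult a P) (smult a Q) = cst a * two_family d e e' P Q"
  by (simp add: two_family_def cst_mult sum_distrib_left mult.assoc distrib_left)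

lemma two_family_zero [simp]: "two_family d e e' 0 0 = 0"
  by (simp add: two_family_def)

lemma sum_single_coeff:
  fixes h :: "nat \<Rightarrow> ('x, 'k::field) pol"
  assumes "finite S" and "i \<in> S"
  shows "(\<Sum>j\<in>S. cst (coeff (monom 1 i) j) * h j) = h i"
proof -
  have "(\<Sum>j\<in>S. cst (coeff (monom 1 i) j) * h j) = (\<Sum>j\<in>S. if j = i then h j else 0)"
    by (rule sum.cong) auto
  then show ?thesis using assms by simp
qed

lemma two_family_monom_left: "i \<le> d \<Longrightarrow> two_family d e e' (monom 1 i) 0 = e i"
  by (simp add: two_family_def sum_single_coeff del: coeff_monom)

lemma two_family_monom_right: "i < d \<Longrightarrow> two_family d e e' 0 (monom 1 i) = e' i"
  by (simp add: two_family_def sum_single_coeff del: coeff_monom)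

text \<open>
  Unlike a bound on the degree, this expresses for \<open>n = 0\<close> that \<open>P\<close> is zero.
\<close>

definition coeff_bounded :: "nat \<Rightarrow> 'k::zero poly \<Rightarrow> bool" where
  "coeff_bounded n P \<longleftrightarrow> (\<forall>i\<ge>n. coeff P i = 0)"

lemma exists_poly_with_coeffs:
  fixes a :: "nat \<Rightarrow> 'k::field"
  shows "\<exists>P. coeff_bounded n P \<and> (\<forall>i<n. coeff P i = a i)"
proof -
  have "coeff (\<Sum>j<n. monom (a j) j) i = (if i < n then a i else 0)" for i
    by (simp add: coeff_sum)
  then show ?thesis by (intro exI[of _ "\<Sum>j<n. monom (a j) j"]) (simp add: coeff_bounded_def)
qed

lemma coeff_bounded_eqI:
  assumes "coeff_bounded n P" "\<And>i. i < n \<Longrightarrow> coeff P i = 0"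
  shows "P = 0"
proof (rule poly_eqI)
  show "coeff P i = coeff 0 i" for i
    using assms by (cases "i < n") (simp_all add: coeff_bounded_def)
qed

lemma coeff_bounded_Suc_iff: "coeff_bounded (Suc d) P \<longleftrightarrow> Polynomial.degree P \<le> d"
  by (auto simp: coeff_bounded_def Suc_le_eq intro: degree_le coeff_eq_0)

lemma coeff_bounded_combination:
  fixes P :: "'k::field poly"
  shows "coeff_bounded n P \<Longrightarrow> coeff_bounded n Q \<Longrightarrow> coeff_bounded n (smult a P + smult b Q)"
  by (simp add: coeff_bounded_def)

lemma two_family_as_sum:
  "two_family d e e' P Q = (\<Sum>i\<in>{..d} <+> {..<d}. cst (case_sum (coeff P) (coeff Q) i) * case_sum e e' i)"
  by (simp add: two_family_def sum.Plus comp_def)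

lemma sum_as_two_family:
  "\<exists>P Q. coeff_bounded (Suc d) P \<and> coeff_bounded d Q \<and>
    (\<forall>i\<le>d. coeff P i = c (Inl i)) \<and> (\<forall>i<d. coeff Q i = c (Inr i)) \<and>
    (\<Sum>i\<in>{..d} <+> {..<d}. cst (c i) * case_sum e e' i) = two_family d e e' P Q"
proof -
  obtain P where P: "coeff_bounded (Suc d) P" "\<forall>i<Suc d. coeff P i = c (Inl i)"
    using exists_poly_with_coeffs[of "Suc d" "\<lambda>i. c (Inl i)"] by blast
  obtain Q where Q: "coeff_bounded d Q" "\<forall>i<d. coeff Q i = c (Inr i)"
    using exists_poly_with_coeffs[of d "\<lambda>i. c (Inr i)"] by blast
  have "(\<Sum>i\<in>{..d} <+> {..<d}. cst (c i) * case_sum e e' i) = two_family d e e' P Q"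
    using P(2) Q(2) by (simp add: two_family_def sum.Plus comp_def)
  with P Q show ?thesis by (intro exI[of _ P] exI[of _ Q]) auto
qed

context graded_quotient
begin

definition spans :: "nat \<Rightarrow> (nat \<Rightarrow> ('x, 'k) pol) \<Rightarrow> (nat \<Rightarrow> ('x, 'k) pol) \<Rightarrow> ('x, 'k) pol \<Rightarrow> bool" where
  "spans d e e' r \<longleftrightarrow> (\<exists>P Q. r \<approx> two_family d e e' P Q)"

lemma spans_add: "spans d e e' r \<Longrightarrow> spans d e e' s \<Longrightarrow> spans d e e' (r + s)"
  unfolding spans_def by (metis eqv_add two_family_add)

lemma spans_cst_mult: "spans d e e' r \<Longrightarrow> spans d e e' (cst a * r)"
  unfolding spans_def by (metis eqv_mult eqv_refl two_family_smult)

lemma spans_eqv: "r \<approx> s \<Longrightarrow> spans d e e' s \<Longrightarrow> spans d e e' r"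
  unfolding spans_def by (metis eqv_trans)

lemma spans_zero: "spans d e e' 0"
  unfolding spans_def by (metis eqv_refl two_family_zero)

lemma spans_left: "i \<le> d \<Longrightarrow> spans d e e' (e i)"
  unfolding spans_def by (metis eqv_refl two_family_monom_left)

lemma spans_right: "i < d \<Longrightarrow> spans d e e' (e' i)"
  unfolding spans_def by (metis eqv_refl two_family_monom_right)

lemma spans_sum: "(\<And>i. i \<in> S \<Longrightarrow> spans d e e' (f i)) \<Longrightarrow> spans d e e' (sum f S)"
  by (induction S rule: infinite_finite_induct) (auto intro: spans_add spans_zero)

text \<open>
  Induction on the degree: it suffices that the coordinates map the families of one degree into the
  span of the families of the next degree.
\<close>

lemma spans_forms:
  fixes e e' :: "nat \<Rightarrow> nat \<Rightarrow> ('x, 'k) pol"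
  assumes xyz: "coordinates x y z" and one: "e 0 0 = 1"
    and left: "\<And>l d i. l \<in> {x, y, z} \<Longrightarrow> i \<le> d \<Longrightarrow> spans (Suc d) (e (Suc d)) (e' (Suc d)) (l * e d i)"
    and right: "\<And>l d i. l \<in> {x, y, z} \<Longrightarrow> i < d \<Longrightarrow> spans (Suc d) (e (Suc d)) (e' (Suc d)) (l * e' d i)"
    and r: "r \<in> forms d"
  shows "spans d (e d) (e' d) r"
  using r
proof (induction rule: form_induct)
  case (const c)
  show ?case using spans_cst_mult[OF spans_left[of 0 0 "e 0" "e' 0"], of c] by (simp add: one)
next
  case (mult d l p)
  let ?s = "spans (Suc d) (e (Suc d)) (e' (Suc d))"
  obtain P Q where "p \<approx> two_family d (e d) (e' d) P Q" using mult(3) unfolding spans_def by blast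
  then have "?s (l' * p)" if "l' \<in> {x, y, z}" for l'
  proof -
    have "l' * p \<approx> l' * two_family d (e d) (e' d) P Q" by (intro eqv_mult eqv_refl) fact
    also have "\<dots> = (\<Sum>i\<le>d. cst (coeff P i) * (l' * e d i)) + (\<Sum>i<d. cst (coeff Q i) * (l' * e' d i))"
      by (simp add: two_family_def distrib_left sum_distrib_left mult_ac)
    finally show ?thesis
      by (rule spans_eqv) (auto intro!: spans_add spans_sum spans_cst_mult left[OF that] right[OF that])
  qed
  then have xyz': "?s (x * p)" "?s (y * p)" "?s (z * p)" by simp_all
  obtain a b c where "l = cst a * x + cst b * y + cst c * z"
    using xyz mult(1) unfolding coordinates_def by blast
  then have "l * p = cst a * (x * p) + cst b * (y * p) + cst c * (z * p)" by (simp add: algebra_simps)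
  also have "?s \<dots>" by (intro spans_add spans_cst_mult xyz')
  finally show ?case .
qed (auto intro: spans_add spans_zero)

text \<open>
  There are \<open>2d+1\<close> spanning elements, as many as the dimension.
\<close>

lemma two_family_unique:
  assumes h: "hilbert_fun I d = 2 * d + 1" and span: "\<And>r. r \<in> forms d \<Longrightarrow> spans d e e' r"
    and P: "coeff_bounded (Suc d) P" and Q: "coeff_bounded d Q" and rel: "two_family d e e' P Q \<in> I"
  shows "P = 0 \<and> Q = 0"
proof -
  let ?S = "{..d} <+> {..<d}"
  have *: "case_sum (coeff P) (coeff Q) j = 0" if "j \<in> ?S" for j
  proof (rule spanning_imp_independent[of ?S d "case_sum e e'"])
    show "hilbert_fun I d = card ?S" by (simp add: h card_Plus)
    show "\<exists>c. r \<approx> (\<Sum>i\<in>?S. cst (c i) * case_sum e e' i)" if "r \<in> forms d" for r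
      using span[OF that] unfolding spans_def two_family_as_sum by blast
    show "(\<Sum>i\<in>?S. cst (case_sum (coeff P) (coeff Q) i) * case_sum e e' i) \<in> I"
      using rel by (simp add: two_family_as_sum)
  qed (use that in auto)
  have "coeff P i = 0" if "i < Suc d" for i using *[of "Inl i"] InlI[of i "{..d}" "{..<d}"] that by simp
  moreover have "coeff Q i = 0" if "i < d" for i using *[of "Inr i"] InrI[of i "{..<d}" "{..d}"] that by simp
  ultimately show ?thesis using coeff_bounded_eqI P Q by blast
qed

text \<open>
  The \<open>2d+1\<close> members of the families exceed the dimension by at least two.
\<close>

lemma exists_two_family_relations:
  assumes h: "hilbert_fun I d < 2 * d" and e: "\<And>i. i \<le> d \<Longrightarrow> e i \<in> forms d" "\<And>i. i < d \<Longrightarrow> e' i \<in> forms d"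
  shows "\<exists>P Q P' Q'. coeff_bounded (Suc d) P \<and> coeff_bounded d Q \<and> coeff_bounded (Suc d) P' \<and> coeff_bounded d Q' \<and>
    two_family d e e' P Q \<in> I \<and> two_family d e e' P' Q' \<in> I \<and>
    (\<forall>a b. smult a P + smult b P' = 0 \<longrightarrow> smult a Q + smult b Q' = 0 \<longrightarrow> a = 0 \<and> b = 0)"
proof -
  let ?S = "{..d} <+> {..<d}"
  have "hilbert_fun I d + 1 < card ?S" using h by (simp add: card_Plus)
  moreover have "case_sum e e' i \<in> forms d" if "i \<in> ?S" for i using that e by auto
  ultimately obtain c c' where rel: "(\<Sum>i\<in>?S. cst (c i) * case_sum e e' i) \<in> I"
      "(\<Sum>i\<in>?S. cst (c' i) * case_sum e e' i) \<in> I"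
    and ind: "\<forall>a b. (\<forall>i\<in>?S. a * c i + b * c' i = 0) \<longrightarrow> a = 0 \<and> b = 0"
    using exists_two_relations[of ?S d "case_sum e e'"] by auto
  obtain P Q where PQ: "coeff_bounded (Suc d) P" "coeff_bounded d Q"
    "\<forall>i\<le>d. coeff P i = c (Inl i)" "\<forall>i<d. coeff Q i = c (Inr i)"
    "(\<Sum>i\<in>?S. cst (c i) * case_sum e e' i) = two_family d e e' P Q"
    using sum_as_two_family[of d c e e'] by blast
  obtain P' Q' where PQ': "coeff_bounded (Suc d) P'" "coeff_bounded d Q'"
    "\<forall>i\<le>d. coeff P' i = c' (Inl i)" "\<forall>i<d. coeff Q' i = c' (Inr i)"
    "(\<Sum>i\<in>?S. cst (c' i) * case_sum e e' i) = two_family d e e' P' Q'"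
    using sum_as_two_family[of d c' e e'] by blast
  have "a = 0 \<and> b = 0" if "smult a P + smult b P' = 0" "smult a Q + smult b Q' = 0" for a b
  proof (rule ind[rule_format])
    fix i assume "i \<in> ?S"
    then show "a * c i + b * c' i = 0"
    proof
      fix j assume j: "i = Inl j" "j \<in> {..d}"
      then show ?thesis using arg_cong[OF that(1), of "\<lambda>p. coeff p j"] PQ(3) PQ'(3) by simp
    next
      fix j assume j: "i = Inr j" "j \<in> {..<d}"
      then show ?thesis using arg_cong[OF that(2), of "\<lambda>p. coeff p j"] PQ(4) PQ'(4) by simp
    qed
  qed
  moreover have "two_family d e e' P Q \<in> I" "two_family d e e' P' Q' \<in> I"
    using rel by (simp_all only: PQ(5) PQ'(5))
  ultimately show ?thesis
    using PQ(1,2) PQ'(1,2) by (intro exI[of _ P, OF exI[of _ Q, OF exI[of _ P', OF exI[of _ Q']]]]) simp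
qed

text \<open>
  The equation of the conic removes every product of \<open>x\<close> and \<open>z\<close>, so monomials without \<open>z\<close> or
  without \<open>x\<close> are enough.
\<close>

lemma conic_monomials_span:
  assumes xyz: "coordinates x y z" and q: "x * z \<approx> cst c * y\<^sup>2" and r: "r \<in> forms d"
  shows "spans d (\<lambda>i. y ^ i * x ^ (d - i)) (\<lambda>i. y ^ i * z ^ (d - i)) r"
proof (rule spans_forms[where e = "\<lambda>d i. y ^ i * x ^ (d - i)" and e' = "\<lambda>d i. y ^ i * z ^ (d - i)",
      OF xyz _ _ _ r])
  fix l d i assume l: "l \<in> {x, y, z}"
  let ?s = "spans (Suc d) (\<lambda>i. y ^ i * x ^ (Suc d - i)) (\<lambda>i. y ^ i * z ^ (Suc d - i))"
  have left: "?s (y ^ i * x ^ j)" if "i + j = Suc d" for i j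
  proof -
    have "j = Suc d - i" "i \<le> Suc d" using that by auto
    then show ?thesis
      using spans_left[of i "Suc d" "\<lambda>i. y ^ i * x ^ (Suc d - i)"] by blast
  qed
  have right: "?s (y ^ i * z ^ j)" if "i + j = Suc d" for i j
  proof (cases "j = 0")
    case True
    then show ?thesis using left[of i 0] that by simp
  next
    case False
    then have "j = Suc d - i" "i < Suc d" using that by auto
    then show ?thesis
      using spans_right[where d = "Suc d" and i = i and e' = "\<lambda>i. y ^ i * z ^ (Suc d - i)"] by blast
  qed
  have reduce: "?s ((x * z) * (y ^ i * u))" if "?s (y ^ Suc (Suc i) * u)" for i u
  proof (rule spans_eqv)
    have "(x * z) * (y ^ i * u) \<approx> (cst c * y\<^sup>2) * (y ^ i * u)"
      by (intro eqv_mult eqv_refl q)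
    also have "\<dots> = cst c * (y ^ Suc (Suc i) * u)" by (simp add: power2_eq_square mult_ac)
    finally show "(x * z) * (y ^ i * u) \<approx> cst c * (y ^ Suc (Suc i) * u)" .
    show "?s (cst c * (y ^ Suc (Suc i) * u))" by (intro spans_cst_mult that)
  qed
  {
    assume i: "i \<le> d"
    have "?s (x * (y ^ i * x ^ (d - i)))" using left[of i "Suc (d - i)"] i by (simp add: mult_ac)
    moreover have "?s (y * (y ^ i * x ^ (d - i)))"
      using left[of "Suc i" "d - i"] i by (simp add: mult_ac)
    moreover have "?s (z * (y ^ i * x ^ (d - i)))"
    proof (cases "i = d")
      case True
      then show ?thesis using right[of d 1] by (simp add: mult_ac)
    next
      case False
      then obtain k where k: "d - i = Suc k" using i by (cases "d - i") auto
      have "?s (y ^ Suc (Suc i) * x ^ k)" using k i by (intro left) simp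
      from reduce[OF this] show ?thesis by (simp add: k mult_ac)
    qed
    ultimately show "?s (l * (y ^ i * x ^ (d - i)))" using l by auto
  }
  {
    assume i: "i < d"
    then obtain k where k: "d - i = Suc k" by (cases "d - i") auto
    have "?s (y ^ Suc (Suc i) * z ^ k)" using k i by (intro right) simp
    from reduce[OF this] have "?s (x * (y ^ i * z ^ (d - i)))" by (simp add: k mult_ac)
    moreover have "?s (y * (y ^ i * z ^ (d - i)))"
      using right[of "Suc i" "d - i"] i by (simp add: mult_ac)
    moreover have "?s (z * (y ^ i * z ^ (d - i)))"
      using right[of i "Suc (d - i)"] i by (simp add: mult_ac)
    ultimately show "?s (l * (y ^ i * z ^ (d - i)))" using l by auto
  }
qed simp

text \<open>
  Monomials divisible by \<open>x\<^sup>2\<close> vanish.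
\<close>

lemma double_line_monomials_span:
  assumes xyz: "coordinates x y z" and q: "x\<^sup>2 \<in> I" and r: "r \<in> forms d"
  shows "spans d (\<lambda>i. y ^ i * z ^ (d - i)) (\<lambda>i. x * (y ^ i * z ^ (d - 1 - i))) r"
proof (rule spans_forms[where e = "\<lambda>d i. y ^ i * z ^ (d - i)"
      and e' = "\<lambda>d i. x * (y ^ i * z ^ (d - 1 - i))", OF xyz _ _ _ r])
  fix l d i assume l: "l \<in> {x, y, z}"
  let ?s = "spans (Suc d) (\<lambda>i. y ^ i * z ^ (Suc d - i)) (\<lambda>i. x * (y ^ i * z ^ (Suc d - 1 - i)))"
  have left: "?s (y ^ i * z ^ j)" if "i + j = Suc d" for i j
  proof -
    have "j = Suc d - i" "i \<le> Suc d" using that by auto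
    then show ?thesis
      using spans_left[of i "Suc d" "\<lambda>i. y ^ i * z ^ (Suc d - i)"] by blast
  qed
  have right: "?s (x * (y ^ i * z ^ j))" if "i + j = d" for i j
  proof -
    have "j = Suc d - 1 - i" "i < Suc d" using that by auto
    then show ?thesis
      using spans_right[where d = "Suc d" and i = i and e' = "\<lambda>i. x * (y ^ i * z ^ (Suc d - 1 - i))"] by blast
  qed
  {
    assume i: "i \<le> d"
    have "?s (x * (y ^ i * z ^ (d - i)))" using right[of i "d - i"] i by simp
    moreover have "?s (y * (y ^ i * z ^ (d - i)))"
      using left[of "Suc i" "d - i"] i by (simp add: mult_ac)
    moreover have "?s (z * (y ^ i * z ^ (d - i)))"
      using left[of i "Suc (d - i)"] i by (simp add: mult_ac)
    ultimately show "?s (l * (y ^ i * z ^ (d - i)))" using l by auto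
  }
  {
    assume i: "i < d"
    have "x * (x * (y ^ i * z ^ (d - 1 - i))) \<approx> 0"
      using mult_mem[OF q, of "y ^ i * z ^ (d - 1 - i)"] by (simp add: eqv_def power2_eq_square mult_ac)
    then have "?s (x * (x * (y ^ i * z ^ (d - 1 - i))))" by (rule spans_eqv) (rule spans_zero)
    moreover have "?s (y * (x * (y ^ i * z ^ (d - 1 - i))))"
      using right[of "Suc i" "d - 1 - i"] i by (simp add: mult_ac)
    moreover have "?s (z * (x * (y ^ i * z ^ (d - 1 - i))))"
      using right[of i "Suc (d - 1 - i)"] i by (simp add: mult_ac)
    ultimately show "?s (l * (x * (y ^ i * z ^ (d - 1 - i))))" using l by auto
  }
qed simp

end

section \<open>Restriction to a line\<close>

text \<open>
  Cramer's rule.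
\<close>

lemma cancel_determinant:
  fixes a :: "('x::finite, 'k::field) pol"
  assumes "comm_ideal J" and f: "cst f1 * a + cst f2 * b \<in> J" and g: "cst g1 * a + cst g2 * b \<in> J"
    and det: "f1 * g2 - f2 * g1 \<noteq> 0"
  shows "a \<in> J" and "b \<in> J"
proof -
  interpret comm_ideal J by fact
  let ?D = "f1 * g2 - f2 * g1"
  have unit: "h \<in> J" if "cst ?D * h \<in> J" for h :: "('x, 'k) pol"
    using mult_mem[OF that, of "cst (inverse ?D)"] det by (simp flip: mult.assoc cst_mult)
  have "cst ?D * a = cst g2 * (cst f1 * a + cst f2 * b) - cst f2 * (cst g1 * a + cst g2 * b)"
    by (simp add: cst_hom algebra_simps)
  also have "\<dots> \<in> J" by (intro diff_mem mult_mem f g)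
  finally show "a \<in> J" by (rule unit)
  have "cst ?D * b = cst f1 * (cst g1 * a + cst g2 * b) - cst g1 * (cst f1 * a + cst f2 * b)"
    by (simp add: cst_hom algebra_simps)
  also have "\<dots> \<in> J" by (intro diff_mem mult_mem f g)
  finally show "b \<in> J" by (rule unit)
qed

locale pol_ideal = comm_ideal J for J :: "('x::finite, 'k::field) pol set"
begin

definition has_coords :: "('x, 'k) pol \<Rightarrow> ('x, 'k) pol \<Rightarrow> ('x, 'k) pol \<Rightarrow> 'k \<Rightarrow> 'k \<Rightarrow> bool" where
  "has_coords u v r a b \<longleftrightarrow> eqv r (cst a * u + cst b * v)"

lemma coords_add: "has_coords u v r a b \<Longrightarrow> has_coords u v s a' b' \<Longrightarrow> has_coords u v (r + s) (a + a') (b + b')"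
  using eqv_add[of r "cst a * u + cst b * v" s "cst a' * u + cst b' * v"]
  by (simp add: has_coords_def single_add algebra_simps)

lemma coords_cst_mult: "has_coords u v r a b \<Longrightarrow> has_coords u v (cst c * r) (c * a) (c * b)"
  using eqv_mult[of "cst c" "cst c" r "cst a * u + cst b * v"]
  by (simp add: has_coords_def cst_mult algebra_simps)

lemma coords_sum:
  "(\<And>i. i \<in> S \<Longrightarrow> has_coords u v (f i) (a i) (b i)) \<Longrightarrow> has_coords u v (sum f S) (sum a S) (sum b S)"
proof (induction S rule: infinite_finite_induct)
  case (insert i S)
  then show ?case by (simp add: coords_add)
qed (simp_all add: has_coords_def)

lemma coords_two_family:
  assumes "\<And>i. i \<le> d \<Longrightarrow> has_coords u v (e i) (a i) (b i)"
    and "\<And>i. i < d \<Longrightarrow> has_coords u v (e' i) (a' i) (b' i)"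
  shows "has_coords u v (two_family d e e' P Q)
    ((\<Sum>i\<le>d. coeff P i * a i) + (\<Sum>i<d. coeff Q i * a' i))
    ((\<Sum>i\<le>d. coeff P i * b i) + (\<Sum>i<d. coeff Q i * b' i))"
  unfolding two_family_def using assms by (intro coords_add coords_sum coords_cst_mult) simp_all

lemma coords_mult_linear:
  assumes pq: "p * q \<in> J" and n: "n > 0" and r: "has_coords (p ^ n) (q ^ n) r a b"
    and u: "has_coords p q u a' b'"
  shows "has_coords (p ^ Suc n) (q ^ Suc n) (u * r) (a' * a) (b' * b)"
proof -
  obtain k where k: "n = Suc k" using n by (cases n) auto
  have "eqv (u * r) ((cst a' * p + cst b' * q) * (cst a * p ^ n + cst b * q ^ n))"
    using r u by (intro eqv_mult) (simp_all add: has_coords_def)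
  also have "(cst a' * p + cst b' * q) * (cst a * p ^ n + cst b * q ^ n) =
      cst (a' * a) * p ^ Suc n + cst (b' * b) * q ^ Suc n
        + (cst (a' * b) * q ^ k + cst (b' * a) * p ^ k) * (p * q)"
    by (simp add: k cst_mult algebra_simps)
  also have "eqv \<dots> (cst (a' * a) * p ^ Suc n + cst (b' * b) * q ^ Suc n)"
    using mult_mem[OF pq] by (simp add: eqv_def)
  finally show ?thesis by (simp add: has_coords_def)
qed

lemma coords_mult_power:
  assumes pq: "p * q \<in> J" and n: "n > 0" and r: "has_coords (p ^ n) (q ^ n) r a b"
    and u: "has_coords p q u a' b'"
  shows "has_coords (p ^ (i + n)) (q ^ (i + n)) (u ^ i * r) (a' ^ i * a) (b' ^ i * b)"
proof (induction i)
  case (Suc i)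
  from coords_mult_linear[OF pq _ Suc u] n show ?case by (simp add: mult.assoc)
qed (use r in simp)

text \<open>
  If \<open>p q = 0\<close>, then \<open>p\<close> and \<open>q\<close> behave like the coordinate functions of two points on a line, and
  the coordinates of a product are the products of the values at these points. In degree zero this
  fails, since \<open>1\<close> is not \<open>p\<^sup>0 + q\<^sup>0\<close>; hence the assumption \<open>d > 0\<close>.
\<close>

lemma coords_monomial:
  assumes pq: "p * q \<in> J" and u: "has_coords p q u a b" and v: "has_coords p q v a' b'"
    and d: "i \<le> d" "d > 0"
  shows "has_coords (p ^ d) (q ^ d) (u ^ i * v ^ (d - i)) (a ^ i * a' ^ (d - i)) (b ^ i * b' ^ (d - i))"
proof -
  have power: "has_coords (p ^ Suc k) (q ^ Suc k) (w ^ Suc k) (g ^ Suc k) (h ^ Suc k)"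
    if "has_coords p q w g h" for w g h k
    using coords_mult_power[OF pq, of 1 w g h w g h k] that by (simp add: mult_ac)
  show ?thesis
  proof (cases "i = d")
    case True
    then show ?thesis using power[OF u, of "d - 1"] d(2) by simp
  next
    case False
    then obtain k where "d - i = Suc k" using d(1) by (cases "d - i") auto
    then have "has_coords (p ^ (d - i)) (q ^ (d - i)) (v ^ (d - i)) (a' ^ (d - i)) (b' ^ (d - i))"
      using power[OF v, of k] by simp
    from coords_mult_power[OF pq _ this u, of i] False d show ?thesis by simp
  qed
qed

end

context graded_quotient
begin

definition ideal_plus :: "('x, 'k) pol \<Rightarrow> ('x, 'k) pol set" where
  "ideal_plus l = {l * a + b | a b. b \<in> I}"

lemma ideal_plus_memI: "b \<in> I \<Longrightarrow> l * a + b \<in> ideal_plus l"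
  by (auto simp: ideal_plus_def)

lemma ideal_plus_ideal: "comm_ideal (ideal_plus l)"
proof
  show "0 \<in> ideal_plus l" using ideal_plus_memI[of 0 l 0] by simp
next
  fix u v assume "u \<in> ideal_plus l" "v \<in> ideal_plus l"
  then obtain a b a' b' where "u = l * a + b" "b \<in> I" "v = l * a' + b'" "b' \<in> I"
    by (auto simp: ideal_plus_def)
  then show "u + v \<in> ideal_plus l"
    using ideal_plus_memI[OF add_mem, of b b' l "a + a'"] by (simp add: algebra_simps)
next
  fix u r assume "u \<in> ideal_plus l"
  then obtain a b where "u = l * a + b" "b \<in> I" by (auto simp: ideal_plus_def)
  then show "r * u \<in> ideal_plus l"
    using ideal_plus_memI[OF mult_mem, of b l "r * a" r] by (simp add: algebra_simps)
qed

lemma ideal_plus_self: "l \<in> ideal_plus l"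
  using ideal_plus_memI[of 0 l 1] by simp

lemma ideal_plus_incl: "b \<in> I \<Longrightarrow> b \<in> ideal_plus l"
  using ideal_plus_memI[of b l 0] by simp

text \<open>
  The cofactor of \<open>l\<close> may be replaced by its component of degree \<open>m\<close>, as \<open>I\<close> is homogeneous.
\<close>

lemma ideal_plus_form:
  assumes l: "l \<in> forms 1" and r: "r \<in> forms (Suc m)" "r \<in> ideal_plus l"
  shows "\<exists>a\<in>forms m. r \<approx> l * a"
proof -
  obtain a b where "r = l * a + b" "b \<in> I" using r(2) by (auto simp: ideal_plus_def)
  then have "component (Suc m) (r - l * a) \<in> I" using component_mem by simp
  then have "r \<approx> l * component m a"
    by (simp add: eqv_def component_diff component_form[OF r(1)] component_linear_mult[OF l])
  then show ?thesis using component_in_forms by blast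
qed

lemma pol_ideal_plus: "pol_ideal (ideal_plus l)"
  by (intro pol_ideal.intro ideal_plus_ideal)

text \<open>
  Modulo \<open>I + (l)\<close> the forms of degree \<open>m+1\<close> are spanned by \<open>u\<close> and \<open>v\<close>. Two elements of \<open>I\<close> with
  nonzero determinant force \<open>u\<close> and \<open>v\<close>, and hence all these forms, into \<open>I + (l)\<close>.
\<close>

lemma lefschetz_of_two_generators:
  assumes l: "l \<in> forms 1"
    and span: "\<And>r. r \<in> forms (Suc m) \<Longrightarrow> spans (Suc m) e e' r"
    and e: "\<And>i. i \<le> Suc m \<Longrightarrow> pol_ideal.has_coords (ideal_plus l) u v (e i) (a i) (b i)"
    and e': "\<And>i. i < Suc m \<Longrightarrow> pol_ideal.has_coords (ideal_plus l) u v (e' i) (a' i) (b' i)"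
    and rel: "two_family (Suc m) e e' P Q \<in> I" "two_family (Suc m) e e' P' Q' \<in> I"
    and det: "((\<Sum>i\<le>Suc m. coeff P i * a i) + (\<Sum>i<Suc m. coeff Q i * a' i)) *
        ((\<Sum>i\<le>Suc m. coeff P' i * b i) + (\<Sum>i<Suc m. coeff Q' i * b' i)) \<noteq>
      ((\<Sum>i\<le>Suc m. coeff P i * b i) + (\<Sum>i<Suc m. coeff Q i * b' i)) *
        ((\<Sum>i\<le>Suc m. coeff P' i * a i) + (\<Sum>i<Suc m. coeff Q' i * a' i))"
  shows "\<exists>l\<in>forms 1. \<forall>r\<in>forms (Suc m). \<exists>a\<in>forms m. r \<approx> l * a"
proof -
  interpret J: pol_ideal "ideal_plus l" by (rule pol_ideal_plus)
  have coords: "J.eqv (two_family (Suc m) e e' P Q)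
      (cst ((\<Sum>i\<le>Suc m. coeff P i * a i) + (\<Sum>i<Suc m. coeff Q i * a' i)) * u +
       cst ((\<Sum>i\<le>Suc m. coeff P i * b i) + (\<Sum>i<Suc m. coeff Q i * b' i)) * v)" for P Q
    using e e' unfolding J.has_coords_def[symmetric] by (intro J.coords_two_family) auto
  have "cst ((\<Sum>i\<le>Suc m. coeff P i * a i) + (\<Sum>i<Suc m. coeff Q i * a' i)) * u +
      cst ((\<Sum>i\<le>Suc m. coeff P i * b i) + (\<Sum>i<Suc m. coeff Q i * b' i)) * v \<in> ideal_plus l"
    if "two_family (Suc m) e e' P Q \<in> I" for P Q
    using J.eqv_mem_iff[OF coords] ideal_plus_incl[OF that] by blast
  from cancel_determinant[OF ideal_plus_ideal this[OF rel(1)] this[OF rel(2)]] det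
  have uv: "u \<in> ideal_plus l" "v \<in> ideal_plus l" by simp_all
  have "\<exists>a\<in>forms m. r \<approx> l * a" if r: "r \<in> forms (Suc m)" for r
  proof -
    obtain P Q where "r \<approx> two_family (Suc m) e e' P Q" using span[OF r] unfolding spans_def by blast
    then have "J.eqv r (two_family (Suc m) e e' P Q)"
      using ideal_plus_incl by (simp add: eqv_def J.eqv_def)
    from J.eqv_trans[OF this coords] have "r \<in> ideal_plus l"
      using J.eqv_mem_iff J.add_mem J.mult_mem uv by blast
    then show ?thesis by (rule ideal_plus_form[OF l r])
  qed
  with l show ?thesis by blast
qed

end

section \<open>Values along a conic and a double line\<close>

lemma poly_as_bounded_sum:
  fixes P :: "'k::field poly"
  assumes "coeff_bounded n P"
  shows "poly P t = (\<Sum>i<n. coeff P i * t ^ i)"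
proof -
  have "P = (\<Sum>i<n. monom (coeff P i) i)"
    using assms by (intro poly_eqI) (simp add: coeff_sum coeff_bounded_def)
  then have "poly P t = poly (\<Sum>i<n. monom (coeff P i) i) t" by (rule arg_cong)
  also have "\<dots> = (\<Sum>i<n. coeff P i * t ^ i)" by (simp add: poly_sum Polynomial.poly_monom)
  finally show ?thesis .
qed

lemma poly_pderiv_as_bounded_sum:
  fixes P :: "'k::field poly"
  assumes "coeff_bounded n P"
  shows "poly (pderiv P) t = (\<Sum>i<n. coeff P i * (of_nat i * t ^ (i - 1)))"
proof -
  have "P = (\<Sum>i<n. monom (coeff P i) i)"
    using assms by (intro poly_eqI) (simp add: coeff_sum coeff_bounded_def)
  then have "poly (pderiv P) t = poly (pderiv (\<Sum>i<n. monom (coeff P i) i)) t"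
    by (rule arg_cong)
  also have "\<dots> = (\<Sum>i<n. coeff P i * (of_nat i * t ^ (i - 1)))"
    by (simp add: higher_pderiv_sum[of 1, simplified] pderiv_monom poly_sum Polynomial.poly_monom mult_ac)
  finally show ?thesis .
qed

text \<open>
  The points \<open>(1, t, c t\<^sup>2)\<close> and \<open>(c s\<^sup>2, s, 1)\<close> make up the conic \<open>x z = c y\<^sup>2\<close>, apart from the
  vertex \<open>(0, 1, 0)\<close> if \<open>c = 0\<close>. The polynomials
  \<open>first_chart\<close> and \<open>second_chart\<close> are the restrictions to them of the form with coefficients \<open>P\<close>
  (monomials in \<open>y\<close> and \<open>x\<close>) and \<open>Q\<close> (monomials in \<open>y\<close> and \<open>z\<close>). For \<open>c = 0\<close> the charts parametrize
  the two lines \<open>z = 0\<close> and \<open>x = 0\<close>.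
\<close>

definition first_chart :: "'k::field \<Rightarrow> nat \<Rightarrow> 'k poly \<Rightarrow> 'k poly \<Rightarrow> 'k poly" where
  "first_chart c d P Q = P + (\<Sum>i<d. monom (coeff Q i * c ^ (d - i)) (2 * d - i))"

definition second_chart :: "'k::field \<Rightarrow> nat \<Rightarrow> 'k poly \<Rightarrow> 'k poly \<Rightarrow> 'k poly" where
  "second_chart c d P Q = Q + (\<Sum>i\<le>d. monom (coeff P i * c ^ (d - i)) (2 * d - i))"

lemma monom_sum_linear:
  fixes P P' :: "'k::field poly"
  shows "(\<Sum>i\<in>S. monom (coeff (smult a P + smult b P') i * h i) (k i)) =
    smult a (\<Sum>i\<in>S. monom (coeff P i * h i) (k i)) + smult b (\<Sum>i\<in>S. monom (coeff P' i * h i) (k i))"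
proof (induction S rule: infinite_finite_induct)
  case (insert j S)
  have "monom (coeff (smult a P + smult b P') j * h j) (k j) =
      smult a (monom (coeff P j * h j) (k j)) + smult b (monom (coeff P' j * h j) (k j))"
    by (simp add: smult_monom add_monom algebra_simps)
  with insert.IH show ?case by (simp only: sum.insert[OF insert.hyps] smult_add_right add_ac)
qed simp_all

lemma first_chart_linear:
  "first_chart c d (smult a P + smult b P') (smult a Q + smult b Q') = smult a (first_chart c d P Q) + smult b (first_chart c d P' Q')"
  by (simp only: first_chart_def monom_sum_linear smult_add_right add_ac)

lemma second_chart_linear:
  "second_chart c d (smult a P + smult b P') (smult a Q + smult b Q') = smult a (second_chart c d P Q) + smult b (second_chart c d P' Q')"
  by (simp only: second_chart_def monom_sum_linear smult_add_right add_ac)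

lemma chart_power:
  fixes c t :: "'k::field"
  assumes i: "i \<le> d"
  shows "t ^ i * (c * t\<^sup>2) ^ (d - i) = c ^ (d - i) * t ^ (2 * d - i)"
proof -
  have "t ^ (2 * d - i) = t ^ (i + 2 * (d - i))" using i by (intro arg_cong[of _ _ "power t"]) simp
  moreover have "t ^ i * (c * t\<^sup>2) ^ (d - i) = c ^ (d - i) * t ^ (i + 2 * (d - i))"
    by (simp add: power_add power_mult_distrib mult_ac flip: power_mult)
  ultimately show ?thesis by simp
qed

lemma poly_first_chart:
  assumes "coeff_bounded (Suc d) P"
  shows "poly (first_chart c d P Q) t =
    (\<Sum>i\<le>d. coeff P i * t ^ i) + (\<Sum>i<d. coeff Q i * (t ^ i * (c * t\<^sup>2) ^ (d - i)))"
  using poly_as_bounded_sum[OF assms, of t]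
  by (simp add: first_chart_def poly_sum Polynomial.poly_monom chart_power lessThan_Suc_atMost mult_ac)

lemma poly_second_chart:
  assumes "coeff_bounded d Q"
  shows "poly (second_chart c d P Q) s =
    (\<Sum>i\<le>d. coeff P i * (s ^ i * (c * s\<^sup>2) ^ (d - i))) + (\<Sum>i<d. coeff Q i * s ^ i)"
  using poly_as_bounded_sum[OF assms, of s]
  by (simp add: second_chart_def poly_sum Polynomial.poly_monom chart_power mult_ac)

text \<open>
  The coefficients of \<open>P\<close> and, up to powers of \<open>c\<close>, those of \<open>Q\<close> appear in different degrees, \<open>i \<le> d\<close>
  for \<open>P\<close> and \<open>2 d - i > d\<close> for \<open>Q\<close>, so they can be read off from the restriction.
\<close>

lemma first_chart_eq_zero:
  assumes P: "coeff_bounded (Suc d) P" and Q: "coeff_bounded d Q" and zero: "first_chart c d P Q = 0"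
  shows "P = 0" and "c \<noteq> 0 \<Longrightarrow> Q = 0"
proof -
  have co: "coeff P j + (\<Sum>i<d. if 2 * d - i = j then coeff Q i * c ^ (d - i) else 0) = 0" for j
    using arg_cong[OF zero, of "\<lambda>p. coeff p j"] by (simp add: first_chart_def coeff_sum)
  show P0: "P = 0"
  proof (rule coeff_bounded_eqI[OF P])
    fix j assume "j < Suc d"
    then have "(\<Sum>i<d. if 2 * d - i = j then coeff Q i * c ^ (d - i) else 0) = 0"
      by (intro sum.neutral) auto
    with co[of j] show "coeff P j = 0" by simp
  qed
  assume c: "c \<noteq> 0"
  show "Q = 0"
  proof (rule coeff_bounded_eqI[OF Q])
    fix j assume j: "j < d"
    have "(\<Sum>i<d. if 2 * d - i = 2 * d - j then coeff Q i * c ^ (d - i) else 0) =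
        (\<Sum>i<d. if i = j then coeff Q i * c ^ (d - i) else 0)"
      using j by (intro sum.cong) auto
    with co[of "2 * d - j"] j c show "coeff Q j = 0" by (simp add: P0)
  qed
qed

lemma second_chart_eq_zero:
  assumes P: "coeff_bounded (Suc d) P" and Q: "coeff_bounded d Q" and zero: "second_chart c d P Q = 0"
  shows "Q = 0" and "coeff_bounded d P" and "c \<noteq> 0 \<Longrightarrow> P = 0"
proof -
  have co: "coeff Q j + (\<Sum>i\<le>d. if 2 * d - i = j then coeff P i * c ^ (d - i) else 0) = 0" for j
    using arg_cong[OF zero, of "\<lambda>p. coeff p j"] by (simp add: second_chart_def coeff_sum)
  show Q0: "Q = 0"
  proof (rule coeff_bounded_eqI[OF Q])
    fix j assume "j < d"
    then have "(\<Sum>i\<le>d. if 2 * d - i = j then coeff P i * c ^ (d - i) else 0) = 0"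
      by (intro sum.neutral) auto
    with co[of j] show "coeff Q j = 0" by simp
  qed
  have top: "coeff P j * c ^ (d - j) = 0" if j: "j \<le> d" for j
  proof -
    have "(\<Sum>i\<le>d. if 2 * d - i = 2 * d - j then coeff P i * c ^ (d - i) else 0) =
        (\<Sum>i\<le>d. if i = j then coeff P i * c ^ (d - i) else 0)"
      using j by (intro sum.cong) auto
    with co[of "2 * d - j"] j show ?thesis by (simp add: Q0)
  qed
  from top[of d] P show "coeff_bounded d P"
    by (auto simp: coeff_bounded_def) (metis Suc_leI le_neq_implies_less)
  assume "c \<noteq> 0"
  with top show "P = 0" by (intro coeff_bounded_eqI[OF P]) auto
qed

text \<open>
  The determinant is a polynomial in \<open>s\<close> for fixed \<open>t\<close> and has infinitely many zeros, so it vanishes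
  identically. Then the pairs \<open>(F, G)(t)\<close> and \<open>(F', G')(s)\<close> are all proportional, and one linear
  relation holds for all of them.
\<close>

lemma charts_dependent:
  fixes F F' G G' :: "'k::field_char_0 poly"
  assumes det: "\<And>s t. (c * s * t)\<^sup>2 \<noteq> 1 \<Longrightarrow> poly F t * poly G' s = poly F' s * poly G t"
    and F: "F \<noteq> 0 \<or> G \<noteq> 0" and F': "F' \<noteq> 0 \<or> G' \<noteq> 0"
  obtains a b where "a \<noteq> 0 \<or> b \<noteq> 0" "smult a F + smult b G = 0" "smult a F' + smult b G' = 0"
proof -
  have all: "smult (poly F t) G' = smult (poly G t) F'" for t
  proof -
    define D where "D = smult (poly F t) G' - smult (poly G t) F'"
    have "{s. (c * s * t)\<^sup>2 = 1} = {s. poly [:-1, 0, (c * t)\<^sup>2:] s = 0}"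
      by (auto simp: power2_eq_square algebra_simps)
    then have "finite {s. (c * s * t)\<^sup>2 = 1}" by (simp add: poly_roots_finite del: poly_pCons)
    then have "infinite (UNIV - {s. (c * s * t)\<^sup>2 = 1})" by (simp add: infinite_UNIV_char_0)
    moreover have "UNIV - {s. (c * s * t)\<^sup>2 = 1} \<subseteq> {s. poly D s = 0}"
      using det by (auto simp: D_def mult.commute)
    ultimately have "infinite {s. poly D s = 0}" using finite_subset by blast
    then have "D = 0" using poly_roots_finite by blast
    then show ?thesis by (simp add: D_def)
  qed
  obtain t0 where t0: "poly F t0 \<noteq> 0 \<or> poly G t0 \<noteq> 0" using F poly_all_0_iff_0 by blast
  obtain s0 where s0: "poly F' s0 \<noteq> 0 \<or> poly G' s0 \<noteq> 0" using F' poly_all_0_iff_0 by blast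
  have cross: "poly F t * poly G' s0 = poly G t * poly F' s0" for t
    using arg_cong[OF all[of t], of "\<lambda>p. poly p s0"] by simp
  have "poly (smult (poly G t0) F - smult (poly F t0) G) t = 0" for t
  proof (cases "poly G' s0 = 0")
    case True
    then have "poly F' s0 \<noteq> 0" using s0 by simp
    then show ?thesis using cross[of t] cross[of t0] True by simp
  next
    case False
    have "(poly G t0 * poly F t) * poly G' s0 = poly G t0 * (poly G t * poly F' s0)"
      using cross[of t] by (simp add: mult.assoc)
    also have "\<dots> = (poly F t0 * poly G t) * poly G' s0"
      using cross[of t0] by (simp add: mult_ac)
    finally show ?thesis using False by simp
  qed
  then have "smult (poly G t0) F - smult (poly F t0) G = 0" using poly_all_0_iff_0 by blast
  then show thesis
    using that[of "poly G t0" "- poly F t0"] t0 all[of t0] by auto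
qed

context graded_quotient
begin

text \<open>
  The line \<open>l\<close> joins \<open>(1, t, c t\<^sup>2)\<close> and \<open>(c s\<^sup>2, s, 1)\<close>, and \<open>u\<close>, \<open>v\<close> are the coordinates on this line
  with respect to the two points. Restricted to the line, the equation of the conic is a nonzero
  multiple of \<open>u v\<close>. The condition on \<open>c s t\<close> keeps the two points distinct and the coefficient of
  \<open>y\<close> in \<open>l\<close> nonzero.
\<close>

lemma conic_secant:
  assumes xyz: "coordinates x y z" and q: "x * z \<approx> cst c * y\<^sup>2" and st: "(c * s * t)\<^sup>2 \<noteq> 1"
    and PQ: "coeff_bounded (Suc (Suc m)) P" "coeff_bounded (Suc m) Q"
      "two_family (Suc m) (\<lambda>i. y ^ i * x ^ (Suc m - i)) (\<lambda>i. y ^ i * z ^ (Suc m - i)) P Q \<in> I"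
    and PQ': "coeff_bounded (Suc (Suc m)) P'" "coeff_bounded (Suc m) Q'"
      "two_family (Suc m) (\<lambda>i. y ^ i * x ^ (Suc m - i)) (\<lambda>i. y ^ i * z ^ (Suc m - i)) P' Q' \<in> I"
    and det: "poly (first_chart c (Suc m) P Q) t * poly (second_chart c (Suc m) P' Q') s \<noteq>
      poly (second_chart c (Suc m) P Q) s * poly (first_chart c (Suc m) P' Q') t"
  shows "\<exists>l\<in>forms 1. \<forall>r\<in>forms (Suc m). \<exists>a\<in>forms m. r \<approx> l * a"
proof -
  (* the determinant that inverts x = u + c s^2 v, z = c t^2 u + v *)
  define D where "D = 1 - (c * s * t)\<^sup>2"
  have D: "D \<noteq> 0" using st by (simp add: D_def)
  have D_eq: "D = (1 - c * s * t) * (1 + c * s * t)"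
    by (simp add: D_def power2_eq_square algebra_simps)
  define l where "l = cst t * x - cst (1 + c * s * t) * y + cst s * z"
  have l: "l \<in> forms 1"
    using xyz by (auto simp: l_def coordinates_def intro!: forms_add forms_diff forms_cst_mult)
  define u where "u = cst (inverse D) * (x - cst (c * s\<^sup>2) * z)"
  define v where "v = cst (inverse D) * (z - cst (c * t\<^sup>2) * x)"
  interpret J: pol_ideal "ideal_plus l" by (rule pol_ideal_plus)
  have x: "x = u + cst (c * s\<^sup>2) * v"
  proof -
    have "u + cst (c * s\<^sup>2) * v = cst (inverse D * D) * x"
      by (simp add: u_def v_def D_def cst_hom power2_eq_square algebra_simps)
    then show ?thesis using D by simp
  qed
  have z: "z = cst (c * t\<^sup>2) * u + v"
  proof -
    have "cst (c * t\<^sup>2) * u + v = cst (inverse D * D) * z"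
      by (simp add: u_def v_def D_def cst_hom power2_eq_square algebra_simps)
    then show ?thesis using D by simp
  qed
  have y: "y - (cst t * u + cst s * v) \<in> ideal_plus l"
  proof -
    define E where "E = 1 + c * s * t"
    have E: "E \<noteq> 0" using D by (auto simp: D_eq E_def)
    have l_eq: "l = cst E * (cst t * u + cst s * v - y)"
    proof -
      have "cst t * x + cst s * z = cst E * (cst t * u + cst s * v)"
        unfolding x z by (simp add: E_def cst_hom power2_eq_square algebra_simps)
      then show ?thesis unfolding l_def E_def[symmetric] by (simp add: algebra_simps)
    qed
    have "cst (- inverse E) * l = cst (- inverse E * E) * (cst t * u + cst s * v - y)"
      by (simp only: l_eq cst_mult mult.assoc)
    also have "\<dots> = y - (cst t * u + cst s * v)" using E by (simp add: single_uminus)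
    finally show ?thesis using J.mult_mem[OF ideal_plus_self] by metis
  qed
  have uv: "u * v \<in> ideal_plus l"
  proof -
    define E where "E = (1 - c * s * t)\<^sup>2"
    have E: "E \<noteq> 0" using D by (auto simp: D_eq E_def)
    let ?y = "cst t * u + cst s * v"
    have 1: "x * z - cst c * y\<^sup>2 \<in> ideal_plus l" using q ideal_plus_incl by (simp add: eqv_def)
    have 2: "cst c * (y\<^sup>2 - ?y\<^sup>2) \<in> ideal_plus l"
      using J.mult_mem[OF y, of "cst c * (y + ?y)"] by (simp add: power2_eq_square algebra_simps)
    have "x * z - cst c * ?y\<^sup>2 = cst E * (u * v)"
      unfolding x z by (simp add: E_def cst_hom power2_eq_square algebra_simps)
    moreover have "x * z - cst c * ?y\<^sup>2 \<in> ideal_plus l"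
      using J.add_mem[OF 1 2] by (simp add: algebra_simps)
    ultimately have "cst (inverse E) * (cst E * (u * v)) \<in> ideal_plus l"
      using J.mult_mem by simp
    moreover have "cst (inverse E) * (cst E * (u * v)) = cst (inverse E * E) * (u * v)"
      by (simp only: cst_mult mult.assoc)
    ultimately show ?thesis using E by simp
  qed
  have X: "J.has_coords u v x 1 (c * s\<^sup>2)" using x by (simp add: J.has_coords_def)
  have Y: "J.has_coords u v y t s" using y by (simp add: J.has_coords_def J.eqv_def)
  have Z: "J.has_coords u v z (c * t\<^sup>2) 1" using z by (simp add: J.has_coords_def)
  show ?thesis
  proof (rule lefschetz_of_two_generators[OF l conic_monomials_span[OF xyz q] _ _ PQ(3) PQ'(3)])
    show "J.has_coords (u ^ Suc m) (v ^ Suc m) (y ^ i * x ^ (Suc m - i))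
        (t ^ i) (s ^ i * (c * s\<^sup>2) ^ (Suc m - i))" if "i \<le> Suc m" for i
      using J.coords_monomial[OF uv Y X that] by simp
    show "J.has_coords (u ^ Suc m) (v ^ Suc m) (y ^ i * z ^ (Suc m - i))
        (t ^ i * (c * t\<^sup>2) ^ (Suc m - i)) (s ^ i)" if "i < Suc m" for i
      using J.coords_monomial[OF uv Y Z, of i "Suc m"] that by simp
  qed (assumption, fact det[unfolded poly_first_chart[OF PQ(1)] poly_first_chart[OF PQ'(1)]
      poly_second_chart[OF PQ(2)] poly_second_chart[OF PQ'(2)]])
qed

text \<open>
  The line \<open>y = t z + s x\<close> meets the double line in a single point with a tangent direction. Modulo
  \<open>x\<^sup>2\<close> a form of degree \<open>m+1\<close> restricts to a combination of \<open>z\<^bsup>m+1\<^esup>\<close> and \<open>x z\<^sup>m\<close>: its value at the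
  point and its derivative in that direction.
\<close>

lemma double_line_secant:
  assumes xyz: "coordinates x y z" and q: "x\<^sup>2 \<in> I"
    and PQ: "coeff_bounded (Suc (Suc m)) P" "coeff_bounded (Suc m) Q"
      "two_family (Suc m) (\<lambda>i. y ^ i * z ^ (Suc m - i)) (\<lambda>i. x * (y ^ i * z ^ (Suc m - 1 - i))) P Q \<in> I"
    and PQ': "coeff_bounded (Suc (Suc m)) P'" "coeff_bounded (Suc m) Q'"
      "two_family (Suc m) (\<lambda>i. y ^ i * z ^ (Suc m - i)) (\<lambda>i. x * (y ^ i * z ^ (Suc m - 1 - i))) P' Q' \<in> I"
    and det: "poly P t * (s * poly (pderiv P') t + poly Q' t) \<noteq>
      (s * poly (pderiv P) t + poly Q t) * poly P' t"
  shows "\<exists>l\<in>forms 1. \<forall>r\<in>forms (Suc m). \<exists>a\<in>forms m. r \<approx> l * a"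
proof -
  define l where "l = y - (cst t * z + cst s * x)"
  have l: "l \<in> forms 1"
    using xyz by (auto simp: l_def coordinates_def intro!: forms_add forms_diff forms_cst_mult)
  interpret J: pol_ideal "ideal_plus l" by (rule pol_ideal_plus)
  have y: "J.eqv y (cst t * z + cst s * x)" 
    using ideal_plus_self[of l] unfolding J.eqv_def by (simp add: l_def)
  have xx: "x * x * h \<in> ideal_plus l" for h
    using J.mult_mem[OF ideal_plus_incl[OF q], of h] by (simp add: power2_eq_square mult_ac)
  have left: "J.has_coords (z ^ (i + j)) (x * z ^ (i + j - 1)) (y ^ i * z ^ j)
      (t ^ i) (s * (of_nat i * t ^ (i - 1)))" for i j
  proof (induction i)
    case 0
    show ?case by (simp add: J.has_coords_def)
  next
    case (Suc i)
    let ?n = "i + j"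
    have "J.eqv (y * (y ^ i * z ^ j)) ((cst t * z + cst s * x) *
        (cst (t ^ i) * z ^ ?n + cst (s * (of_nat i * t ^ (i - 1))) * (x * z ^ (?n - 1))))"
      using Suc y by (intro J.eqv_mult) (simp_all add: J.has_coords_def)
    also have "J.eqv \<dots> (cst (t ^ Suc i) * z ^ Suc ?n + cst (s * (of_nat (Suc i) * t ^ i)) * (x * z ^ ?n))"
    proof (cases "?n = 0")
      case True
      then show ?thesis by (simp add: J.eqv_def)
    next
      case False
      then obtain k where k: "?n = Suc k" by (cases ?n) auto
      define w where "w = s * (of_nat i * t ^ (i - 1))"
      have "s * (of_nat (Suc i) * t ^ i) = t * w + s * t ^ i"
        by (cases i) (simp_all add: w_def algebra_simps)
      then have step: "cst (s * (of_nat (Suc i) * t ^ i)) = cst t * cst w + cst s * cst (t ^ i)"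
        by (simp only: single_add cst_mult)
      have "(cst t * z + cst s * x) * (cst (t ^ i) * z ^ ?n + cst w * (x * z ^ (?n - 1))) -
          (cst (t ^ Suc i) * z ^ Suc ?n + cst (s * (of_nat (Suc i) * t ^ i)) * (x * z ^ ?n)) =
          x * x * (cst s * cst w * z ^ k)"
        unfolding k step by (simp add: cst_mult algebra_simps)
      then show ?thesis using xx unfolding w_def by (simp only: J.eqv_def)
    qed
    finally show ?case by (simp add: J.has_coords_def mult_ac)
  qed
  have right: "J.has_coords (z ^ Suc n) (x * z ^ n) (x * (y ^ i * z ^ (n - i))) 0 (t ^ i)"
    if "i \<le> n" for i n
  proof -
    have "J.eqv (x * (y ^ i * z ^ (n - i)))
        (x * (cst (t ^ i) * z ^ n + cst (s * (of_nat i * t ^ (i - 1))) * (x * z ^ (n - 1))))"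
      using left[of i "n - i"] that by (intro J.eqv_mult) (simp_all add: J.has_coords_def)
    also have "x * (cst (t ^ i) * z ^ n + cst (s * (of_nat i * t ^ (i - 1))) * (x * z ^ (n - 1))) =
        cst (t ^ i) * (x * z ^ n) + x * x * (cst (s * (of_nat i * t ^ (i - 1))) * z ^ (n - 1))"
      by (simp add: algebra_simps)
    also have "J.eqv \<dots> (cst 0 * z ^ Suc n + cst (t ^ i) * (x * z ^ n))"
      using xx by (simp add: J.eqv_def)
    finally show ?thesis by (simp add: J.has_coords_def)
  qed
  show ?thesis
  proof (rule lefschetz_of_two_generators[OF l double_line_monomials_span[OF xyz q] _ _ PQ(3) PQ'(3)])
    show "J.has_coords (z ^ Suc m) (x * z ^ m) (y ^ i * z ^ (Suc m - i)) (t ^ i) (s * (of_nat i * t ^ (i - 1)))"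
      if "i \<le> Suc m" for i
      using left[of i "Suc m - i"] that by simp
    show "J.has_coords (z ^ Suc m) (x * z ^ m) (x * (y ^ i * z ^ (Suc m - 1 - i))) 0 (t ^ i)"
      if "i < Suc m" for i
      using right[of i m] that by simp
    have P: "(\<Sum>i\<le>Suc m. coeff P i * t ^ i) + (\<Sum>i<Suc m. coeff Q i * 0) = poly P t"
      "(\<Sum>i\<le>Suc m. coeff P i * (s * (of_nat i * t ^ (i - 1)))) + (\<Sum>i<Suc m. coeff Q i * t ^ i)
        = s * poly (pderiv P) t + poly Q t"
      if "coeff_bounded (Suc (Suc m)) P" "coeff_bounded (Suc m) Q" for P Q
      using that by (simp_all add: poly_as_bounded_sum poly_pderiv_as_bounded_sum
          lessThan_Suc_atMost sum_distrib_left mult_ac del: sum.lessThan_Suc sum.atMost_Suc)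
    show "((\<Sum>i\<le>Suc m. coeff P i * t ^ i) + (\<Sum>i<Suc m. coeff Q i * 0)) *
        ((\<Sum>i\<le>Suc m. coeff P' i * (s * (of_nat i * t ^ (i - 1)))) + (\<Sum>i<Suc m. coeff Q' i * t ^ i)) \<noteq>
      ((\<Sum>i\<le>Suc m. coeff P i * (s * (of_nat i * t ^ (i - 1)))) + (\<Sum>i<Suc m. coeff Q i * t ^ i)) *
        ((\<Sum>i\<le>Suc m. coeff P' i * t ^ i) + (\<Sum>i<Suc m. coeff Q' i * 0))"
      unfolding P[OF PQ(1,2)] P[OF PQ'(1,2)] by (rule det)
  qed
qed

end

section \<open>The weak Lefschetz property\<close>

lemma two_family_conic_right:
  "two_family (Suc k) e (\<lambda>i. y ^ i * z ^ (Suc k - i)) 0 Q = z * binary_form k Q y z"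
proof -
  have "two_family (Suc k) e (\<lambda>i. y ^ i * z ^ (Suc k - i)) 0 Q =
      (\<Sum>i\<le>k. cst (coeff Q i) * (y ^ i * z ^ (Suc k - i)))"
    by (simp add: two_family_def lessThan_Suc_atMost del: sum.lessThan_Suc)
  also have "\<dots> = (\<Sum>i\<le>k. z * (cst (coeff Q i) * (y ^ i * z ^ (k - i))))"
    by (intro sum.cong) (auto simp: Suc_diff_le mult_ac)
  finally show ?thesis by (simp add: binary_form_def sum_distrib_left)
qed

lemma two_family_conic_left:
  assumes "coeff_bounded (Suc k) P"
  shows "two_family (Suc k) (\<lambda>i. y ^ i * x ^ (Suc k - i)) e' P 0 = x * binary_form k P y x"
proof -
  have "two_family (Suc k) (\<lambda>i. y ^ i * x ^ (Suc k - i)) e' P 0 = binary_form (Suc k) P y x"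
    by (simp add: two_family_def binary_form_def)
  then show ?thesis
    using assms binary_form_times_second[of P k x y] by (simp add: coeff_bounded_Suc_iff)
qed

lemma two_family_double_line_right:
  "two_family (Suc k) e (\<lambda>i. x * (y ^ i * z ^ (Suc k - 1 - i))) 0 Q = x * binary_form k Q y z"
  by (simp add: two_family_def binary_form_def lessThan_Suc_atMost sum_distrib_left mult_ac
      del: sum.lessThan_Suc)

text \<open>
  The consequences of the hypotheses that the two cases have in common.
\<close>

locale odd_gorenstein = graded_quotient I for I :: "('x::finite, 'k::field_char_0) pol set" +
  fixes m :: nat
  assumes m: "m \<ge> 1"
    and socle_top: "socle I \<subseteq> graded_piece I (socle_degree I)"
    and socle_degree: "socle_degree I = 2 * m + 1"
    and top: "hilbert_fun I (2 * m + 1) = 1"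
    and middle: "hilbert_fun I m = 2 * m + 1" "hilbert_fun I (Suc m) = 2 * m + 1"
begin

notation eqv (infix \<open>\<approx>\<close> 50)

lemma annihilated_pair_dependent:
  assumes "coordinates x y z" and "w \<in> forms 1" and "w * x \<in> I"
    and "\<And>P. coeff_bounded m P \<Longrightarrow> w * binary_form (m - 1) P y z \<in> I \<Longrightarrow> P = 0"
    and "coeff_bounded (Suc m) F" "w * binary_form m F y z \<in> I"
    and "coeff_bounded (Suc m) G" "w * binary_form m G y z \<in> I"
  shows "\<not> lin_indep2 F G"
proof (rule annihilated_binary_forms_dependent[OF socle_top socle_degree top m assms(1-3)])
  fix P :: "'k poly"
  assume "Polynomial.degree P \<le> m - 1" "w * binary_form (m - 1) P y z \<in> I"
  moreover have "Suc (m - 1) = m" using m by simp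
  ultimately show "P = 0" using assms(4)[of P] coeff_bounded_Suc_iff[of "m - 1" P] by simp
qed (use assms in \<open>auto simp: coeff_bounded_Suc_iff\<close>)

text \<open>
  If every secant fails, the charts of the two relations are proportional. When neither pair of charts
  vanishes, the relations themselves are dependent. A vanishing pair leaves only \<open>c = 0\<close> and two
  multiples of the same linear form.
\<close>

lemma multiplication_onto_conic:
  assumes xyz: "coordinates x y z" and q: "x * z \<approx> cst c * y\<^sup>2"
  shows "\<exists>l\<in>forms 1. \<forall>r\<in>forms (Suc m). \<exists>a\<in>forms m. r \<approx> l * a"
proof (rule ccontr)
  assume none: "\<not> ?thesis"
  let ?e = "\<lambda>d i. y ^ i * x ^ (d - i)" and ?e' = "\<lambda>d i. y ^ i * z ^ (d - i)"
  have x: "x \<in> forms 1" and y: "y \<in> forms 1" and z: "z \<in> forms 1"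
    using xyz by (auto simp: coordinates_def)
  have e: "?e d i \<in> forms d" "?e' d i \<in> forms d" if "i \<le> d" for d i
    using forms_monomial[OF y x, of i "d - i"] forms_monomial[OF y z, of i "d - i"] that by simp_all
  obtain P Q P' Q' where P: "coeff_bounded (Suc (Suc m)) P" "coeff_bounded (Suc m) Q"
      "two_family (Suc m) (?e (Suc m)) (?e' (Suc m)) P Q \<in> I"
    and P': "coeff_bounded (Suc (Suc m)) P'" "coeff_bounded (Suc m) Q'"
      "two_family (Suc m) (?e (Suc m)) (?e' (Suc m)) P' Q' \<in> I"
    and indep: "\<forall>a b. smult a P + smult b P' = 0 \<longrightarrow> smult a Q + smult b Q' = 0 \<longrightarrow> a = 0 \<and> b = 0"
    using exists_two_family_relations[of "Suc m" "?e (Suc m)" "?e' (Suc m)"] middle(2) e by auto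
  have unique: "P = 0 \<and> Q = 0" if "coeff_bounded (Suc m) P" "coeff_bounded m Q"
      "two_family m (?e m) (?e' m) P Q \<in> I" for P Q
    using two_family_unique[OF _ conic_monomials_span[OF xyz q] that] middle(1) by simp
  have m': "Suc (m - 1) = m" using m by simp
  let ?F = "first_chart c (Suc m) P Q" and ?G = "first_chart c (Suc m) P' Q'"
  let ?F' = "second_chart c (Suc m) P Q" and ?G' = "second_chart c (Suc m) P' Q'"
  have det: "poly ?F t * poly ?G' s = poly ?F' s * poly ?G t" if "(c * s * t)\<^sup>2 \<noteq> 1" for s t
    using conic_secant[OF xyz q that P P'] none by blast
  consider "?F = 0" "?G = 0" | "?F' = 0" "?G' = 0" | "?F \<noteq> 0 \<or> ?G \<noteq> 0" "?F' \<noteq> 0 \<or> ?G' \<noteq> 0"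
    by blast
  then show False
  proof cases
    case 1
    have P0: "P = 0" "P' = 0"
      using first_chart_eq_zero(1)[OF P(1,2) 1(1)] first_chart_eq_zero(1)[OF P'(1,2) 1(2)] by simp_all
    have "c = 0"
    proof (rule ccontr)
      assume c: "c \<noteq> 0"
      have "Q = 0" "Q' = 0"
        using first_chart_eq_zero(2)[OF P(1,2) 1(1) c] first_chart_eq_zero(2)[OF P'(1,2) 1(2) c] by simp_all
      with P0 indep[rule_format, of 1 0] show False by simp
    qed
    then have zx: "z * x \<in> I" using q by (simp add: eqv_def mult.commute)
    (* both relations vanish on the line z = 0, so z is the common factor *)
    have "\<not> lin_indep2 Q Q'"
    proof (rule annihilated_pair_dependent[OF xyz z zx])
      show "p = 0" if "coeff_bounded m p" "z * binary_form (m - 1) p y z \<in> I" for p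
        using unique[of 0 p] that two_family_conic_right[of "m - 1" "?e m" y z p, unfolded m']
        by (simp add: coeff_bounded_def)
    qed (use P P' P0 in \<open>simp_all add: two_family_conic_right\<close>)
    with indep P0 show False by (simp add: lin_indep2_def)
  next
    case 2
    have Q0: "Q = 0" "Q' = 0"
      using second_chart_eq_zero(1)[OF P(1,2) 2(1)] second_chart_eq_zero(1)[OF P'(1,2) 2(2)] by simp_all
    have P0: "coeff_bounded (Suc m) P" "coeff_bounded (Suc m) P'"
      using second_chart_eq_zero(2)[OF P(1,2) 2(1)] second_chart_eq_zero(2)[OF P'(1,2) 2(2)] by simp_all
    have "c = 0"
    proof (rule ccontr)
      assume c: "c \<noteq> 0"
      have "P = 0" "P' = 0"
        using second_chart_eq_zero(3)[OF P(1,2) 2(1) c] second_chart_eq_zero(3)[OF P'(1,2) 2(2) c] by simp_all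
      with Q0 indep[rule_format, of 1 0] show False by simp
    qed
    then have xz: "x * z \<in> I" using q by (simp add: eqv_def)
    have zyx: "coordinates z y x"
      using coordinates_permute(1)[OF coordinates_permute(2)[OF coordinates_permute(1)[OF xyz]]] .
    (* both relations vanish on the line x = 0, so x is the common factor *)
    have "\<not> lin_indep2 P P'"
    proof (rule annihilated_pair_dependent[OF zyx x xz])
      show "p = 0" if p: "coeff_bounded m p" "x * binary_form (m - 1) p y x \<in> I" for p
        using unique[of p 0] p two_family_conic_left[of "m - 1" p y x "?e' m", unfolded m']
        by (simp add: coeff_bounded_def)
    qed (use P P' P0 Q0 in \<open>simp_all add: two_family_conic_left\<close>)
    with indep Q0 show False by (simp add: lin_indep2_def)
  next
    case 3
    obtain a b where ab: "a \<noteq> 0 \<or> b \<noteq> 0" "smult a ?F + smult b ?G = 0" "smult a ?F' + smult b ?G' = 0"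
      using charts_dependent[OF det 3] by blast
    have bounded: "coeff_bounded (Suc (Suc m)) (smult a P + smult b P')"
      "coeff_bounded (Suc m) (smult a Q + smult b Q')"
      using P P' by (simp_all add: coeff_bounded_combination)
    have "smult a P + smult b P' = 0"
      using first_chart_eq_zero(1)[OF bounded, of c] ab(2) by (simp only: first_chart_linear)
    moreover have "smult a Q + smult b Q' = 0"
      using second_chart_eq_zero(1)[OF bounded, of c] ab(3) by (simp only: second_chart_linear)
    ultimately show False using indep ab(1) by blast
  qed
qed

text \<open>
  The determinant of \<open>double_line_secant\<close> is a polynomial of degree one in \<open>s\<close>. Its linear
  coefficient is the Wronskian of \<open>P\<close> and \<open>P'\<close>, so these are dependent; its constant coefficient
  transfers the dependence to \<open>Q\<close> and \<open>Q'\<close> unless \<open>P\<close> and \<open>P'\<close> vanish.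
\<close>

lemma multiplication_onto_double_line:
  assumes xyz: "coordinates x y z" and q: "x\<^sup>2 \<in> I"
  shows "\<exists>l\<in>forms 1. \<forall>r\<in>forms (Suc m). \<exists>a\<in>forms m. r \<approx> l * a"
proof (rule ccontr)
  assume none: "\<not> ?thesis"
  let ?e = "\<lambda>d i. y ^ i * z ^ (d - i)" and ?e' = "\<lambda>d i. x * (y ^ i * z ^ (d - 1 - i))"
  have x: "x \<in> forms 1" and y: "y \<in> forms 1" and z: "z \<in> forms 1"
    using xyz by (auto simp: coordinates_def)
  have e: "?e d i \<in> forms d" if "i \<le> d" for d i
    using forms_monomial[OF y z, of i "d - i"] that by simp
  have e': "?e' d i \<in> forms d" if "i < d" for d i
    using forms_Suc_mult[OF x e[of i "d - 1"]] that by simp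
  obtain P Q P' Q' where P: "coeff_bounded (Suc (Suc m)) P" "coeff_bounded (Suc m) Q"
      "two_family (Suc m) (?e (Suc m)) (?e' (Suc m)) P Q \<in> I"
    and P': "coeff_bounded (Suc (Suc m)) P'" "coeff_bounded (Suc m) Q'"
      "two_family (Suc m) (?e (Suc m)) (?e' (Suc m)) P' Q' \<in> I"
    and indep: "\<forall>a b. smult a P + smult b P' = 0 \<longrightarrow> smult a Q + smult b Q' = 0 \<longrightarrow> a = 0 \<and> b = 0"
    using exists_two_family_relations[of "Suc m" "?e (Suc m)" "?e' (Suc m)"] middle(2) e e'[of _ "Suc m"]
    by auto
  have unique: "P = 0 \<and> Q = 0" if "coeff_bounded (Suc m) P" "coeff_bounded m Q"
      "two_family m (?e m) (?e' m) P Q \<in> I" for P Q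
    using two_family_unique[OF _ double_line_monomials_span[OF xyz q] that] middle(1) by simp
  have m': "Suc (m - 1) = m" using m by simp
  have "poly P t * (s * poly (pderiv P') t + poly Q' t) = (s * poly (pderiv P) t + poly Q t) * poly P' t" for s t
    using double_line_secant[OF xyz q P P'] none by blast
  (* the constant and the linear coefficient in s *)
  from this[where s = 0] this[where s = 1]
  have "poly (P * Q') t = poly (Q * P') t" "poly (P * pderiv P') t = poly (pderiv P * P') t" for t
    by (simp_all add: algebra_simps)
  then have PQ: "P * Q' = Q * P'" and "P * pderiv P' = pderiv P * P'" by (simp_all add: poly_eq_poly_eq_iff[symmetric] fun_eq_iff)
  then obtain a b where ab: "a \<noteq> 0 \<or> b \<noteq> 0" "smult a P + smult b P' = 0"
    using wronskian_nonzero[of P P'] by (auto simp: lin_indep2_def)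
  have "P * (smult a Q + smult b Q') = (smult a P + smult b P') * Q"
    "P' * (smult a Q + smult b Q') = (smult a P + smult b P') * Q'"
    using PQ by (simp_all add: algebra_simps)
  then have P0: "P = 0" "P' = 0" using ab indep by auto
  have "\<not> lin_indep2 Q Q'"
  proof (rule annihilated_pair_dependent[OF xyz x])
    show "x * x \<in> I" using q by (simp add: power2_eq_square)
    show "p = 0" if "coeff_bounded m p" "x * binary_form (m - 1) p y z \<in> I" for p
      using unique[of 0 p] that two_family_double_line_right[of "m - 1" "?e m" x y z p, unfolded m']
      by (simp add: coeff_bounded_def)
  qed (use P P' P0 two_family_double_line_right[of m "?e (Suc m)" x y z] in simp_all)
  with indep P0 show False by (simp add: lin_indep2_def)
qed

end

text \<open>
  There are six monomials of degree two, more than the dimension.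
\<close>

lemma exists_quadric:
  fixes I :: "(3, 'k::field) pol set"
  assumes "graded_quotient I" and h: "hilbert_fun I 2 < 6"
  shows "\<exists>q\<in>forms 2 \<inter> I. q \<noteq> 0"
proof -
  interpret graded_quotient I by fact
  define ex where "ex j = Poly_Mapping.single j (1::nat)" for j :: 3
  define S where "S = {ex 0 + ex 0, ex 0 + ex 1, ex 0 + ex 2, ex 1 + ex 1, ex 1 + ex 2, ex 2 + ex 2}"
  have finite: "finite S" by (simp add: S_def)
  let ?h = "\<lambda>t. (Poly_Mapping.lookup t (0::3), Poly_Mapping.lookup t (1::3))"
  have "?h ` S = {(2, 0), (1, 1), (1, 0), (0, 2), (0, 1), (0, 0)}"
    by (simp add: S_def ex_def lookup_add lookup_single when_def numeral_2_eq_2)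
  then have "card (?h ` S) = 6" by simp
  then have "6 \<le> card S" using card_image_le[OF finite, of ?h] by simp
  with h have card: "hilbert_fun I 2 < card S" by linarith
  have "mon_degree (ex j) = 1" for j by (simp add: ex_def mon_degree_def lookup_single when_def)
  then have "Poly_Mapping.single t (1::'k) \<in> forms 2" if "t \<in> S" for t
    using that by (auto simp: S_def forms_def mon_degree_add)
  then obtain c where c: "\<exists>t\<in>S. c t \<noteq> 0" "(\<Sum>t\<in>S. cst (c t) * Poly_Mapping.single t 1) \<in> I"
    using exists_relation[OF finite card, of "\<lambda>t. Poly_Mapping.single t 1"] by blast
  define q where "q = (\<Sum>t\<in>S. cst (c t) * Poly_Mapping.single t (1::'k))"
  have "Poly_Mapping.lookup q t = c t" if "t \<in> S" for t
    using that finite by (simp add: q_def mult_single lookup_sum lookup_single when_def)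
  then have "q \<noteq> 0" using c(1) by (metis lookup_zero)
  moreover have "q \<in> forms 2" unfolding q_def
    by (intro forms_sum forms_cst_mult) fact
  ultimately show ?thesis using c(2) by (auto simp: q_def)
qed

theorem theorem3p1:
  fixes I :: "(3, 'k::{alg_closed_field, field_char_0}) pol set"
    and m :: nat
  assumes "m \<ge> 1"
    and "homogeneous_ideal I"
    and "artinian I"
    and "gorenstein I"
    and "socle_degree I = 2 * m + 1"
    and "\<And>i. i \<le> m \<Longrightarrow> hilbert_fun I i = 2 * i + 1"
    and "\<And>i. i \<le> m \<Longrightarrow> hilbert_fun I (2 * m + 1 - i) = 2 * i + 1"
  shows "weak_lefschetz I"
proof -
  interpret odd_gorenstein I m
  proof
    show "I \<noteq> UNIV" using gorenstein_imp_proper assms(2,4) .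
    show "socle I \<subseteq> graded_piece I (socle_degree I)" using assms(4) by (simp add: gorenstein_def)
    show "hilbert_fun I (2 * m + 1) = 1" using assms(7)[of 0] by simp
    show "hilbert_fun I (Suc m) = 2 * m + 1" using assms(7)[of m] by (simp add: Suc_diff_le mult_2)
  qed (use assms in auto)
  have "hilbert_fun I 2 < 6"
  proof (cases "m = 1")
    case True
    then show ?thesis using assms(7)[of 1] by simp
  next
    case False
    then show ?thesis using assms(1) assms(6)[of 2] by simp
  qed
  then obtain q where q: "q \<in> forms 2" "q \<in> I" "q \<noteq> 0" using exists_quadric[OF graded_quotient_axioms] by auto
  from coordinates_variables[where 'k = 'k] q(1,3)
  have "\<exists>l\<in>forms 1. \<forall>r\<in>forms (Suc m). \<exists>a\<in>forms m. r \<approx> l * a"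
  proof (cases rule: quadric_normal_form)
    case (conic x y z c)
    then show ?thesis using multiplication_onto_conic[OF conic(1), of c] q(2) by (simp add: eqv_def)
  next
    case (double_line x y z k)
    have "x\<^sup>2 = cst (inverse k) * q"
      using double_line(2) by (simp add: double_line(3) flip: mult.assoc cst_mult)
    then have "x\<^sup>2 \<in> I" using mult_mem[OF q(2)] by simp
    then show ?thesis by (rule multiplication_onto_double_line[OF double_line(1)])
  qed
  then show ?thesis using weak_lefschetzI[OF socle_top socle_degree] by blast
qed

end
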